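(* There is an efficient (polynomial-time) algorithm that, given a network contribution game in which every reward function is of the form $f_e(x,y)=c_e\cdot(x+y)$ with arbitrary constants $c_e>0$ ($e\in E$), decides whether a pairwise equilibrium exists and computes one if one exists. Moreover, for this class of games the price of anarchy for pairwise equilibria is $1$, i.e., whenever a pairwise equilibrium exists, every pairwise equilibrium has social welfare equal to that of a social optimum.
   Context: Network contribution game: a finite simple undirected graph $G=(V,E)$; every node $v\in V$ is a player with budget $B_v\ge 0$. Let $E_v$ be the set of edges incident to $v$. A strategy of $v$ is a function $s_v:E_v\to\mathbb{R}_{\ge 0}$ with $\sum_{e\in E_v}s_v(e)\le B_v$; a state $s=(s_v)_{v\in V}$ consists of one strategy per player. Each edge $e=(u,v)$ has a reward function $f_e:\mathbb{R}_{\ge 0}^2\to\mathbb{R}_{\ge 0}$. The utility of $v$ is $w_v(s)=\sum_{e=(v,u)\in E_v}f_e(s_v(e),s_u(e))$, and the social welfare is $w(s)=\sum_{v\in V}w_v(s)$. A social optimum $s^*$ is a state maximizing $w$. A state $s$ is a (pure) Nash equilibrium if $w_v(s)\ge w_v(s_v',s_{-v})$ for every player $v$ and every strategy $s_v'$. An improving bilateral deviation in $s$ is a pair of strategies $(s_u',s_v')$ of two players $u\neq v$ with $w_u(s_u',s_v',s_{-u,v})>w_u(s)$ and $w_v(s_u',s_v',s_{-u,v})>w_v(s)$. A pairwise equilibrium is a Nash equilibrium that admits no improving bilateral deviation. The price of anarchy (for pairwise equilibria) of a game is the largest ratio $w(s^* )/w(s)$ over pairwise equilibria $s$; for a class of games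 it is the worst such value over all games in the class that have a pairwise equilibrium. *)

theory Defs
  imports
    Complex_Main
    "HOL-Library.Extended_Real"
    "HOL-Library.Discrete_Functions"
    "HOL-Computational_Algebra.Polynomial"
begin

section \<open>Network contribution games\<close>

text \<open>An edge is a two-element set of nodes. Only the values \<open>budget v\<close> for \<open>v \<in> nodes\<close> and
  \<open>reward e x y\<close> for \<open>e \<in> edges\<close> and \<open>x, y \<ge> 0\<close> matter.\<close>

record 'v game =
  nodes :: "'v set"
  edges :: "'v set set"
  budget :: "'v \<Rightarrow> real"
  reward :: "'v set \<Rightarrow> real \<Rightarrow> real \<Rightarrow> real"

definition contribution_game :: "'v game \<Rightarrow> bool" where
  "contribution_game G \<longleftrightarrow>
     finite (nodes G) \<and>
     (\<forall>e\<in>edges G. \<exists>u v. u \<in> nodes G \<and> v \<in> nodes G \<and> u \<noteq> v \<and> e = {u, v}) \<and>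
     (\<forall>v\<in>nodes G. 0 \<le> budget G v) \<and>
     (\<forall>e\<in>edges G. \<forall>x\<ge>0. \<forall>y\<ge>0. 0 \<le> reward G e x y)"

definition incident_edges :: "'v game \<Rightarrow> 'v \<Rightarrow> 'v set set" where
  "incident_edges G v = {e \<in> edges G. v \<in> e}"

text \<open>A strategy of \<open>v\<close> is represented by a total function on edges, of which only the values on the
  edges incident to \<open>v\<close> are constrained or ever used.\<close>

definition strategies :: "'v game \<Rightarrow> 'v \<Rightarrow> ('v set \<Rightarrow> real) set" where
  "strategies G v =
     {x. (\<forall>e\<in>incident_edges G v. 0 \<le> x e) \<and> (\<Sum>e\<in>incident_edges G v. x e) \<le> budget G v}"

type_synonym 'v state = "'v \<Rightarrow> 'v set \<Rightarrow> real"

definition states :: "'v game \<Rightarrow> 'v state set" where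
  "states G = {s. \<forall>v\<in>nodes G. s v \<in> strategies G v}"

text \<open>As the graph is simple, summing over the edges at \<open>v\<close> is summing over the neighbours of \<open>v\<close>.\<close>

definition utility :: "'v game \<Rightarrow> 'v state \<Rightarrow> 'v \<Rightarrow> real" where
  "utility G s v = (\<Sum>u | {v, u} \<in> edges G. reward G {v, u} (s v {v, u}) (s u {v, u}))"

definition welfare :: "'v game \<Rightarrow> 'v state \<Rightarrow> real" where
  "welfare G s = (\<Sum>v\<in>nodes G. utility G s v)"

definition social_optimum :: "'v game \<Rightarrow> 'v state \<Rightarrow> bool" where
  "social_optimum G s \<longleftrightarrow> s \<in> states G \<and> (\<forall>t\<in>states G. welfare G t \<le> welfare G s)"

definition nash_equilibrium :: "'v game \<Rightarrow> 'v state \<Rightarrow> bool" where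
  "nash_equilibrium G s \<longleftrightarrow> s \<in> states G \<and>
     (\<forall>v\<in>nodes G. \<forall>x\<in>strategies G v. utility G (s(v := x)) v \<le> utility G s v)"

definition improving_bilateral_deviation ::
  "'v game \<Rightarrow> 'v state \<Rightarrow> 'v \<Rightarrow> 'v \<Rightarrow> ('v set \<Rightarrow> real) \<Rightarrow> ('v set \<Rightarrow> real) \<Rightarrow> bool" where
  "improving_bilateral_deviation G s u v x y \<longleftrightarrow>
     u \<in> nodes G \<and> v \<in> nodes G \<and> u \<noteq> v \<and> x \<in> strategies G u \<and> y \<in> strategies G v \<and>
     utility G (s(u := x, v := y)) u > utility G s u \<and>
     utility G (s(u := x, v := y)) v > utility G s v"

definition pairwise_equilibrium :: "'v game \<Rightarrow> 'v state \<Rightarrow> bool" where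
  "pairwise_equilibrium G s \<longleftrightarrow> nash_equilibrium G s \<and>
     (\<nexists>u v x y. improving_bilateral_deviation G s u v x y)"

text \<open>Welfare ratios live in the extended reals: a positive optimum over a worthless equilibrium is
  \<open>\<infinity>\<close>, and an optimum of welfare 0 (e.g. no edges, or all budgets 0) is matched with ratio 1.\<close>

definition welfare_ratio :: "real \<Rightarrow> real \<Rightarrow> ereal" where
  "welfare_ratio a b = (if b = 0 then (if a = 0 then 1 else \<infinity>) else ereal (a / b))"

definition price_of_anarchy :: "'v game \<Rightarrow> ereal" where
  "price_of_anarchy G =
     Sup {welfare_ratio (welfare G t) (welfare G s) | s t.
            pairwise_equilibrium G s \<and> social_optimum G t}"

definition class_price_of_anarchy :: "'v game set \<Rightarrow> ereal" where
  "class_price_of_anarchy \<G> =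
     (SUP G \<in> {G \<in> \<G>. \<exists>s. pairwise_equilibrium G s}. price_of_anarchy G)"

definition linear_games :: "'v game set" where
  "linear_games = {G. contribution_game G \<and>
     (\<exists>c. \<forall>e\<in>edges G. 0 < c e \<and> (\<forall>x\<ge>0. \<forall>y\<ge>0. reward G e x y = c e * (x + y)))}"


section \<open>Polynomial time\<close>

text \<open>The machine model is a random access machine over the natural numbers with logarithmic cost,
  presented with structured control flow. The memory consists of arrays; a program names finitely
  many of them by constants and addresses their cells by computed indices. Every evaluated
  subexpression is charged the number of binary digits of its value. Like the usual
  logarithmic-cost RAM, this model is polynomially equivalent to Turing machines.\<close>

datatype aexp =
    Num nat
  | Cell nat aexp
  | Plus aexp aexp
  | Minus aexp aexp
  | Times aexp aexp

datatype bexp =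
    Less aexp aexp
  | Equal aexp aexp
  | Neg bexp
  | Conj bexp bexp

datatype com =
    Skip
  | Assign nat aexp aexp  \<comment> \<open>array, index, new value\<close>
  | Seq com com
  | Cond bexp com com
  | While bexp com

type_synonym memory = "nat \<Rightarrow> nat \<Rightarrow> nat"

primrec aval :: "aexp \<Rightarrow> memory \<Rightarrow> nat" where
  "aval (Num k) \<sigma> = k"
| "aval (Cell a i) \<sigma> = \<sigma> a (aval i \<sigma>)"
| "aval (Plus x y) \<sigma> = aval x \<sigma> + aval y \<sigma>"
| "aval (Minus x y) \<sigma> = aval x \<sigma> - aval y \<sigma>"
| "aval (Times x y) \<sigma> = aval x \<sigma> * aval y \<sigma>"

primrec bval :: "bexp \<Rightarrow> memory \<Rightarrow> bool" where
  "bval (Less x y) \<sigma> \<longleftrightarrow> aval x \<sigma> < aval y \<sigma>"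
| "bval (Equal x y) \<sigma> \<longleftrightarrow> aval x \<sigma> = aval y \<sigma>"
| "bval (Neg b) \<sigma> \<longleftrightarrow> \<not> bval b \<sigma>"
| "bval (Conj b c) \<sigma> \<longleftrightarrow> bval b \<sigma> \<and> bval c \<sigma>"

definition bit_length :: "nat \<Rightarrow> nat" where
  "bit_length k = Suc (floor_log k)"

primrec acost :: "aexp \<Rightarrow> memory \<Rightarrow> nat" where
  "acost (Num k) \<sigma> = bit_length k"
| "acost (Cell a i) \<sigma> = acost i \<sigma> + bit_length (\<sigma> a (aval i \<sigma>))"
| "acost (Plus x y) \<sigma> = acost x \<sigma> + acost y \<sigma> + bit_length (aval x \<sigma> + aval y \<sigma>)"
| "acost (Minus x y) \<sigma> = acost x \<sigma> + acost y \<sigma> + bit_length (aval x \<sigma> - aval y \<sigma>)"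
| "acost (Times x y) \<sigma> = acost x \<sigma> + acost y \<sigma> + bit_length (aval x \<sigma> * aval y \<sigma>)"

primrec bcost :: "bexp \<Rightarrow> memory \<Rightarrow> nat" where
  "bcost (Less x y) \<sigma> = acost x \<sigma> + acost y \<sigma>"
| "bcost (Equal x y) \<sigma> = acost x \<sigma> + acost y \<sigma>"
| "bcost (Neg b) \<sigma> = Suc (bcost b \<sigma>)"
| "bcost (Conj b c) \<sigma> = Suc (bcost b \<sigma> + bcost c \<sigma>)"

text \<open>\<open>exec c \<sigma> t \<tau>\<close>: started in memory \<open>\<sigma>\<close>, the program \<open>c\<close> halts in memory \<open>\<tau>\<close> at cost \<open>t\<close>.\<close>

inductive exec :: "com \<Rightarrow> memory \<Rightarrow> nat \<Rightarrow> memory \<Rightarrow> bool" where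
  Skip: "exec Skip \<sigma> 1 \<sigma>"
| Assign: "exec (Assign a i x) \<sigma> (acost i \<sigma> + acost x \<sigma>)
             (\<sigma>(a := (\<sigma> a)(aval i \<sigma> := aval x \<sigma>)))"
| Seq: "exec c \<sigma> t \<sigma>' \<Longrightarrow> exec d \<sigma>' t' \<sigma>'' \<Longrightarrow> exec (Seq c d) \<sigma> (t + t') \<sigma>''"
| CondTrue: "bval b \<sigma> \<Longrightarrow> exec c \<sigma> t \<tau> \<Longrightarrow> exec (Cond b c d) \<sigma> (bcost b \<sigma> + t) \<tau>"
| CondFalse: "\<not> bval b \<sigma> \<Longrightarrow> exec d \<sigma> t \<tau> \<Longrightarrow> exec (Cond b c d) \<sigma> (bcost b \<sigma> + t) \<tau>"
| WhileFalse: "\<not> bval b \<sigma> \<Longrightarrow> exec (While b c) \<sigma> (bcost b \<sigma>) \<sigma>"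
| WhileTrue: "bval b \<sigma> \<Longrightarrow> exec c \<sigma> t \<sigma>' \<Longrightarrow> exec (While b c) \<sigma>' t' \<sigma>'' \<Longrightarrow>
                exec (While b c) \<sigma> (bcost b \<sigma> + t + t') \<sigma>''"

lemma exec_deterministic:
  assumes "exec c \<sigma> t \<tau>" and "exec c \<sigma> t' \<tau>'"
  shows "t' = t \<and> \<tau>' = \<tau>"
  using assms
proof (induction arbitrary: t' \<tau>' rule: exec.induct)
  case (Seq c \<sigma> t \<sigma>' d t1 \<sigma>'')
  from Seq.prems show ?case by (cases rule: exec.cases) (use Seq.IH in blast)+
next
  case (WhileTrue b \<sigma> c t \<sigma>' t1 \<sigma>'')
  from WhileTrue.prems show ?case
    by (cases rule: exec.cases) (use WhileTrue.IH WhileTrue.hyps in blast)+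
qed (erule exec.cases; auto)+

text \<open>Input and output are lists of naturals, stored in arrays 0 and 1, respectively: cell 0 holds
  the length of the list and cells 1, 2, ... its entries. All other cells are initially 0.\<close>

definition input_memory :: "nat list \<Rightarrow> memory" where
  "input_memory xs = (\<lambda>a i.
     if a = 0 then (if i = 0 then length xs else if i \<le> length xs then xs ! (i - 1) else 0) else 0)"

definition output_list :: "memory \<Rightarrow> nat list" where
  "output_list \<sigma> = map (\<lambda>i. \<sigma> 1 (Suc i)) [0..<\<sigma> 1 0]"

definition input_size :: "nat list \<Rightarrow> nat" where
  "input_size xs = (\<Sum>x\<leftarrow>xs. bit_length x)"

text \<open>\<open>poly_time_solves c enc D R\<close>: on every problem instance \<open>I \<in> D\<close>, given by its encoding
  \<open>enc I\<close>, the program \<open>c\<close> halts within time polynomial in the bit size of the encoding, with some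
  output \<open>ys\<close> satisfying \<open>R I ys\<close>.\<close>

definition poly_time_solves ::
  "com \<Rightarrow> ('i \<Rightarrow> nat list) \<Rightarrow> 'i set \<Rightarrow> ('i \<Rightarrow> nat list \<Rightarrow> bool) \<Rightarrow> bool" where
  "poly_time_solves c enc D R \<longleftrightarrow>
     (\<exists>p :: nat poly. \<forall>I\<in>D. \<exists>t \<tau>. exec c (input_memory (enc I)) t \<tau> \<and>
        t \<le> poly p (input_size (enc I)) \<and> R I (output_list \<tau>))"


section \<open>Linear games as inputs\<close>

text \<open>The nodes are \<open>0, \<dots>, n - 1\<close>, where \<open>n\<close> is the length of the list of budgets. An entry
  \<open>(u, v, c)\<close> of the list of links is an edge \<open>{u, v}\<close> with coefficient \<open>c\<close>. Budgets and coefficients are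
  rational, so that they have finite binary descriptions.\<close>

record linear_instance =
  budgets :: "rat list"
  links :: "(nat \<times> nat \<times> rat) list"

definition valid_instance :: "linear_instance \<Rightarrow> bool" where
  "valid_instance I \<longleftrightarrow>
     (\<forall>b\<in>set (budgets I). 0 \<le> b) \<and>
     (\<forall>(u, v, c)\<in>set (links I).
        u < length (budgets I) \<and> v < length (budgets I) \<and> u \<noteq> v \<and> 0 < c) \<and>
     distinct (map (\<lambda>(u, v, c). {u, v}) (links I))"

definition coefficient :: "linear_instance \<Rightarrow> nat set \<Rightarrow> rat" where
  "coefficient I e = the (map_of (map (\<lambda>(u, v, c). ({u, v}, c)) (links I)) e)"

definition game_of :: "linear_instance \<Rightarrow> nat game" where
  "game_of I =
     \<lparr>nodes = {..<length (budgets I)},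
      edges = (\<lambda>(u, v, c). {u, v}) ` set (links I),
      budget = (\<lambda>v. of_rat (budgets I ! v)),
      reward = (\<lambda>e x y. of_rat (coefficient I e) * (x + y))\<rparr>"

lemma game_of_linear:
  assumes "valid_instance I"
  shows "game_of I \<in> linear_games"
proof -
  have pos: "0 < coefficient I {u, v}" if "(u, v, c) \<in> set (links I)" for u v c
  proof -
    let ?xs = "map (\<lambda>(u, v, c). ({u, v}, c)) (links I)"
    have "distinct (map fst ?xs)"
      using assms by (simp add: valid_instance_def case_prod_unfold comp_def)
    moreover have "({u, v}, c) \<in> set ?xs"
      using that by force
    ultimately have "coefficient I {u, v} = c"
      by (simp add: coefficient_def)
    then show ?thesis
      using assms that by (auto simp: valid_instance_def)
  qed
  have ends: "\<exists>a b. a < length (budgets I) \<and> b < length (budgets I) \<and> a \<noteq> b \<and> {u, v} = {a, b}"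
    if "(u, v, c) \<in> set (links I)" for u v c
    using assms that by (fastforce simp: valid_instance_def)
  have nonneg: "0 \<le> budgets I ! v" if "v < length (budgets I)" for v
    using assms that by (simp add: valid_instance_def)
  have "contribution_game (game_of I)"
    unfolding contribution_game_def
  proof (intro conjI ballI allI impI)
    fix e assume "e \<in> edges (game_of I)"
    then show "\<exists>u v. u \<in> nodes (game_of I) \<and> v \<in> nodes (game_of I) \<and> u \<noteq> v \<and> e = {u, v}"
      using ends by (fastforce simp: game_of_def)
  next
    fix e and x y :: real
    assume "e \<in> edges (game_of I)" "0 \<le> x" "0 \<le> y"
    then show "0 \<le> reward (game_of I) e x y"
      by (auto simp: game_of_def intro!: mult_nonneg_nonneg dest!: pos)
  qed (auto simp: game_of_def nonneg)
  then show ?thesis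
    unfolding linear_games_def
    by (auto simp: game_of_def dest!: pos intro!: exI[of _ "\<lambda>e. of_rat (coefficient I e)"])
qed

text \<open>A nonnegative rational is encoded by numerator and denominator in lowest terms.\<close>

definition encode_rat :: "rat \<Rightarrow> nat list" where
  "encode_rat q = (case quotient_of q of (a, b) \<Rightarrow> [nat a, nat b])"

definition encode_instance :: "linear_instance \<Rightarrow> nat list" where
  "encode_instance I =
     length (budgets I) # length (links I) # concat (map encode_rat (budgets I)) @
     concat (map (\<lambda>(u, v, c). [u, v] @ encode_rat c) (links I))"

text \<open>A state is output by listing, for each link in the order of the input, the contributions of its
  two endpoints.\<close>

definition encode_state :: "linear_instance \<Rightarrow> (nat \<Rightarrow> nat set \<Rightarrow> rat) \<Rightarrow> nat list" where
  "encode_state I s =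
     concat (map (\<lambda>(u, v, c). encode_rat (s u {u, v}) @ encode_rat (s v {u, v})) (links I))"

text \<open>The output starts with the decision, 0 or 1; in the latter case an equilibrium follows. In the
  former case no equilibrium exists, among all real-valued states.\<close>

definition equilibrium_answer :: "linear_instance \<Rightarrow> nat list \<Rightarrow> bool" where
  "equilibrium_answer I ys \<longleftrightarrow>
     (if \<exists>s. pairwise_equilibrium (game_of I) s
      then \<exists>s. pairwise_equilibrium (game_of I) (\<lambda>v e. of_rat (s v e)) \<and> ys = 1 # encode_state I s
      else ys = [0])"

end

theory Submission
  imports Defs
begin

text \<open>In a linear game the contributions of the other players enter a player's utility only
  additively, so a Nash equilibrium is a state in which everybody spends the whole budget on incident
  edges of maximal coefficient. Every contribution is rewarded twice, hence such states maximize the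
  welfare and the price of anarchy is 1.

  Let \<open>p\<close> and \<open>q\<close> be the maximal coefficients at the ends of an edge \<open>e\<close>. Shifting amounts \<open>x\<close> and
  \<open>y\<close> to \<open>e\<close> gains the two ends \<open>c y - (p - c) x\<close> and \<open>c x - (q - c) y\<close>, and both can be made positive
  iff \<open>p q < c (p + q)\<close>. So a Nash equilibrium is pairwise iff on every such edge between players of
  positive budget one end spends its whole budget on it. Existence therefore amounts to choosing, for
  each of these edges, an end at which it is maximal, no node being chosen twice. This is an instance
  of 2-satisfiability: choose an end, force the consequences, and on a conflict choose the other end;
  a conflict-free set of choices that is closed under forcing never has to be revised.

  Loops whose bounds are the numbers of nodes or links and whose assignments only copy values run in
  polynomial time.\<close>

section \<open>Equilibria of linear games\<close>

text \<open>The criterion \<open>p q < c (p + q)\<close> is \<open>(p - c) (q - c) < c ^ 2\<close>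
  expanded. Both gains are positive iff \<open>(p - c) x < c y\<close> and
  \<open>(q - c) y < c x\<close>; multiplying eliminates \<open>x\<close> and \<open>y\<close>, and
  conversely amounts in the ratio \<open>x : y = q : p\<close> give both ends the same gain. An end
  with its whole budget on the edge, or with budget 0, cannot raise its contribution, and then its
  partner has nothing to gain. A positive budget cannot lie entirely on two edges, which turns a
  real-valued equilibrium into a choice of ends without repetition. Conversely such a choice yields
  an equilibrium in which every node puts its whole budget on one edge, so rational budgets admit a
  rational equilibrium as soon as a real one exists. For the running time, the obstacle is that
  repeated arithmetic could make stored numbers long. As products and sums occur only in tests and
  indices, one bound \<open>2 ^ L\<close> holds for all cells during the whole run.\<close>

locale linear_game =
  fixes G :: "'v game" and c :: "'v set \<Rightarrow> real"
  assumes game: "contribution_game G"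
    and c_pos: "e \<in> edges G \<Longrightarrow> 0 < c e"
    and reward: "e \<in> edges G \<Longrightarrow> 0 \<le> x \<Longrightarrow> 0 \<le> y \<Longrightarrow> reward G e x y = c e * (x + y)"
begin

abbreviation "V \<equiv> nodes G"
abbreviation "E \<equiv> edges G"
abbreviation "B \<equiv> budget G"
abbreviation "inc \<equiv> incident_edges G"

definition neighbours :: "'v \<Rightarrow> 'v set" where
  "neighbours v = {u. {v, u} \<in> E}"

definition own :: "'v \<Rightarrow> ('v set \<Rightarrow> real) \<Rightarrow> real" where
  "own v x = (\<Sum>e\<in>inc v. c e * x e)"

definition received :: "'v \<Rightarrow> 'v state \<Rightarrow> real" where
  "received v s = (\<Sum>u\<in>neighbours v. c {v, u} * s u {v, u})"

text \<open>The value 0 at an isolated node makes \<open>own v x = top v * B v\<close> true there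
  for every \<open>x\<close>, so the later characterizations cover isolated nodes as well.\<close>

definition top :: "'v \<Rightarrow> real" where
  "top v = (if inc v = {} then 0 else Max (c ` inc v))"

lemma edgeE:
  assumes "e \<in> E" obtains u v where "u \<in> V" "v \<in> V" "u \<noteq> v" "e = {u, v}"
  using assms game unfolding contribution_game_def by blast

lemma edge_ends: "{u, v} \<in> E \<Longrightarrow> u \<in> V \<and> v \<in> V \<and> u \<noteq> v"
  by (erule edgeE) (auto simp: doubleton_eq_iff)

lemma finite_V [simp]: "finite V"
  using game by (simp add: contribution_game_def)

lemma finite_E: "finite E"
proof (rule finite_subset)
  show "E \<subseteq> Pow V" by (auto elim: edgeE)
qed simp

lemma finite_inc [simp]: "finite (inc v)"
  using finite_E by (simp add: incident_edges_def)

lemma neighbours_subset: "neighbours v \<subseteq> V"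
  using edge_ends by (auto simp: neighbours_def)

lemma finite_neighbours [simp]: "finite (neighbours v)"
  using neighbours_subset finite_V by (rule finite_subset)

lemma budget_nonneg: "v \<in> V \<Longrightarrow> 0 \<le> B v"
  using game by (simp add: contribution_game_def)

lemma inc_eq: "inc v = (\<lambda>u. {v, u}) ` neighbours v"
proof -
  have "\<exists>u. e = {v, u}" if "e \<in> E" "v \<in> e" for e
    using that by (auto elim!: edgeE)
  then show ?thesis by (auto simp: incident_edges_def neighbours_def)
qed

lemma sum_inc: "(\<Sum>e\<in>inc v. h e) = (\<Sum>u\<in>neighbours v. h {v, u})"
  unfolding inc_eq by (rule sum.reindex_cong[OF _ refl refl]) (auto simp: inj_on_def doubleton_eq_iff)

lemma statesD: "s \<in> states G \<Longrightarrow> v \<in> V \<Longrightarrow> s v \<in> strategies G v"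
  by (simp add: states_def)

lemma states_update: "s \<in> states G \<Longrightarrow> x \<in> strategies G v \<Longrightarrow> s(v := x) \<in> states G"
  by (simp add: states_def)

lemma strategies_nonneg: "x \<in> strategies G v \<Longrightarrow> e \<in> inc v \<Longrightarrow> 0 \<le> x e"
  by (simp add: strategies_def)

lemma strategies_le:
  assumes "x \<in> strategies G v" "e \<in> inc v" shows "x e \<le> B v"
proof -
  have "x e \<le> (\<Sum>e\<in>inc v. x e)"
    using assms by (intro member_le_sum) (auto simp: strategies_def)
  with assms show ?thesis by (simp add: strategies_def)
qed

lemma utility_eq:
  assumes "s \<in> states G" "v \<in> V"
  shows "utility G s v = own v (s v) + received v s"
proof -
  have "utility G s v = (\<Sum>u\<in>neighbours v. c {v, u} * s v {v, u} + c {v, u} * s u {v, u})"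
    unfolding utility_def neighbours_def
  proof (rule sum.cong[OF refl])
    fix u assume u: "u \<in> {u. {v, u} \<in> E}"
    then have "u \<in> V" using edge_ends by auto
    moreover have "{v, u} \<in> inc v" "{v, u} \<in> inc u" using u by (auto simp: incident_edges_def)
    ultimately have "0 \<le> s v {v, u}" "0 \<le> s u {v, u}"
      using assms by (auto intro: strategies_nonneg[OF statesD])
    then show "reward G {v, u} (s v {v, u}) (s u {v, u}) = c {v, u} * s v {v, u} + c {v, u} * s u {v, u}"
      using u by (simp add: reward algebra_simps)
  qed
  then show ?thesis
    by (simp add: own_def received_def sum_inc sum.distrib)
qed

lemma top_ge: "e \<in> inc v \<Longrightarrow> c e \<le> top v"
  by (auto simp: top_def)

lemma top_nonneg: "0 \<le> top v"
proof (cases "inc v = {}")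
  case False
  then obtain e where e: "e \<in> inc v" by blast
  then have "0 < c e" by (auto simp: incident_edges_def c_pos)
  with top_ge[OF e] show ?thesis by simp
qed (simp add: top_def)

lemma top_attained: "inc v \<noteq> {} \<Longrightarrow> \<exists>e\<in>inc v. c e = top v"
  using Max_in[of "c ` inc v"] by (fastforce simp: top_def image_iff)

text \<open>The shortfall splits into money placed on cheaper edges and money left unspent. For a
  strategy every summand is nonnegative, and all bounds on \<open>own\<close> come from
  this.\<close>

lemma own_slack:
  "top v * B v - own v x = (\<Sum>e\<in>inc v. (top v - c e) * x e) + top v * (B v - (\<Sum>e\<in>inc v. x e))"
  by (simp add: own_def sum_subtractf sum_distrib_left algebra_simps)

lemma own_le_split:
  assumes "x \<in> strategies G v" "e \<in> inc v"
  shows "own v x \<le> top v * B v - (top v - c e) * x e"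
proof -
  have "(top v - c e) * x e \<le> (\<Sum>e\<in>inc v. (top v - c e) * x e)"
    using assms by (intro member_le_sum) (auto intro!: mult_nonneg_nonneg simp: top_ge strategies_def)
  moreover have "0 \<le> top v * (B v - (\<Sum>e\<in>inc v. x e))"
    using assms by (intro mult_nonneg_nonneg top_nonneg) (simp add: strategies_def)
  ultimately show ?thesis using own_slack[of v x] by simp
qed

lemma own_le: "x \<in> strategies G v \<Longrightarrow> own v x \<le> top v * B v"
proof (cases "inc v = {}")
  case False
  assume x: "x \<in> strategies G v"
  from False obtain e where e: "e \<in> inc v" by blast
  have "0 \<le> (top v - c e) * x e"
    using x e by (intro mult_nonneg_nonneg) (auto simp: top_ge strategies_nonneg)
  with own_le_split[OF x e] show ?thesis by simp
qed (simp add: own_def top_def)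

lemma own_top_cheap:
  assumes "x \<in> strategies G v" "own v x = top v * B v" "e \<in> inc v" "c e < top v"
  shows "x e = 0"
proof -
  have "(top v - c e) * x e \<le> 0" using own_le_split[OF assms(1,3)] assms(2) by simp
  then have "x e \<le> 0" using assms(4) by (simp add: mult_le_0_iff)
  with strategies_nonneg[OF assms(1,3)] show ?thesis by simp
qed

lemma concentrated_strategy:
  assumes "v \<in> V"
  shows "(\<lambda>e. if e = g then B v else 0) \<in> strategies G v"
  using assms budget_nonneg[of v] by (auto simp: strategies_def)

lemma own_concentrated:
  "g \<in> inc v \<Longrightarrow> own v (\<lambda>e. if e = g then B v else 0) = c g * B v"
  by (simp add: own_def if_distrib[of "\<lambda>z. _ * z"] sum.delta cong: if_cong)

lemma own_attained: "v \<in> V \<Longrightarrow> \<exists>x\<in>strategies G v. own v x = top v * B v"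
proof (cases "inc v = {}")
  case True
  assume "v \<in> V"
  then show ?thesis using True concentrated_strategy[of v] by (auto simp: own_def top_def)
next
  case False
  assume v: "v \<in> V"
  obtain g where "g \<in> inc v" "c g = top v" using top_attained[OF False] by blast
  then show ?thesis using own_concentrated concentrated_strategy[OF v] by metis
qed

section \<open>Nash equilibria and social welfare\<close>

lemma received_update_self: "received v (s(v := x)) = received v s"
  unfolding received_def by (rule sum.cong[OF refl]) (use edge_ends in \<open>auto simp: neighbours_def\<close>)

lemma received_update:
  "received u (s(v := y)) =
     received u s + (if {u, v} \<in> E then c {u, v} * (y {u, v} - s v {u, v}) else 0)"
proof (cases "{u, v} \<in> E")
  case True
  then have v: "v \<in> neighbours u" by (simp add: neighbours_def)
  have "(\<Sum>w\<in>neighbours u - {v}. c {u, w} * (s(v := y)) w {u, w}) = (\<Sum>w\<in>neighbours u - {v}. c {u, w} * s w {u, w})"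
    by (rule sum.cong) auto
  then show ?thesis
    using True by (simp add: received_def sum.remove[OF _ v] algebra_simps)
next
  case False
  then show ?thesis
    unfolding received_def by (auto simp: neighbours_def intro!: sum.cong)
qed

text \<open>What a player receives does not depend on its own strategy, so best responses maximize
  \<open>own\<close> alone, and its upper bound is attained by concentrating on a best edge.\<close>

lemma nash_iff:
  "nash_equilibrium G s \<longleftrightarrow> s \<in> states G \<and> (\<forall>v\<in>V. own v (s v) = top v * B v)"
proof -
  have "(\<forall>x\<in>strategies G v. utility G (s(v := x)) v \<le> utility G s v) \<longleftrightarrow> own v (s v) = top v * B v"
    if s: "s \<in> states G" and v: "v \<in> V" for v
  proof -
    have "(\<forall>x\<in>strategies G v. utility G (s(v := x)) v \<le> utility G s v) \<longleftrightarrow>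
        (\<forall>x\<in>strategies G v. own v x \<le> own v (s v))"
      using s v by (intro ball_cong refl) (simp add: utility_eq states_update received_update_self)
    also have "\<dots> \<longleftrightarrow> own v (s v) = top v * B v"
      using own_attained[OF v] own_le[of _ v] own_le[OF statesD[OF s v]] by (metis order_antisym)
    finally show ?thesis .
  qed
  then show ?thesis unfolding nash_equilibrium_def by blast
qed

text \<open>Double counting: a contribution of \<open>u\<close> to an edge appears once in the
  earnings of \<open>u\<close> and once in what the other end receives.\<close>

lemma welfare_eq:
  assumes "s \<in> states G"
  shows "welfare G s = 2 * (\<Sum>v\<in>V. own v (s v))"
proof -
  have "(\<Sum>v\<in>V. received v s) = (\<Sum>v\<in>V. \<Sum>u | u \<in> V \<and> {v, u} \<in> E. c {v, u} * s u {v, u})"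
    unfolding received_def neighbours_def using edge_ends by (intro sum.cong refl) auto
  also have "\<dots> = (\<Sum>u\<in>V. \<Sum>v | v \<in> V \<and> {v, u} \<in> E. c {v, u} * s u {v, u})"
    by (rule sum.swap_restrict) auto
  also have "\<dots> = (\<Sum>u\<in>V. own u (s u))"
    unfolding own_def sum_inc neighbours_def using edge_ends
    by (intro sum.cong refl) (auto simp: insert_commute)
  finally show ?thesis
    using assms by (simp add: welfare_def utility_eq sum.distrib)
qed

lemma nash_optimal: "nash_equilibrium G s \<Longrightarrow> t \<in> states G \<Longrightarrow> welfare G t \<le> welfare G s"
  by (auto simp: nash_iff welfare_eq intro!: sum_mono own_le statesD)

text \<open>Otherwise both ends have money that is not yet on the edge, and moving suitable parts of
  it there would be an improving bilateral deviation.\<close>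

lemma contested_edge:
  assumes eq: "pairwise_equilibrium G s" and e: "{u, v} \<in> E"
    and B: "0 < B u" "0 < B v"
    and contested: "top u * top v < c {u, v} * (top u + top v)"
  shows "s u {u, v} = B u \<or> s v {u, v} = B v"
proof (rule ccontr)
  assume not: "\<not> ?thesis"
  let ?e = "{u, v}"
  have nash: "s \<in> states G" "w \<in> V \<Longrightarrow> own w (s w) = top w * B w" for w
    using eq by (auto simp: pairwise_equilibrium_def nash_iff)
  have uv: "u \<in> V" "v \<in> V" "u \<noteq> v" using edge_ends[OF e] by auto
  have inc: "?e \<in> inc u" "?e \<in> inc v" using e by (auto simp: incident_edges_def)
  have pos: "0 < c ?e" using c_pos[OF e] .
  have top: "0 < top u" "0 < top v" using top_ge[OF inc(1)] top_ge[OF inc(2)] pos by linarith+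
  have gap: "0 < B u - s u ?e" "0 < B v - s v ?e"
    using not strategies_le[OF statesD[OF nash(1) uv(1)] inc(1)]
      strategies_le[OF statesD[OF nash(1) uv(2)] inc(2)] by auto
  \<comment> \<open>Shifting an amount \<open>d\<close> to \<open>e\<close> costs exactly \<open>(top w - c e) * d\<close>, because either
    \<open>e\<close> is a best edge of \<open>w\<close> or \<open>w\<close> does not use it.\<close>
  have shift: "\<exists>x\<in>strategies G w. own w x = own w (s w) - (top w - c ?e) * d \<and> x ?e = s w ?e + d"
    if w: "w \<in> V" "?e \<in> inc w" and d: "0 \<le> d" "d \<le> B w - s w ?e" "0 < B w - s w ?e" for w d
  proof -
    \<comment> \<open>The fraction of the way from \<open>s w\<close> to the strategy concentrated
      on \<open>?e\<close>. A convex combination of strategies is a strategy and \<open>own\<close>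
      is linear; this \<open>a\<close> makes the contribution to \<open>?e\<close> grow by exactly
      \<open>d\<close>.\<close>
    define a where "a = d / (B w - s w ?e)"
    have a: "0 \<le> a" "a \<le> 1" using d by (auto simp: a_def)
    define y where "y = (\<lambda>f. if f = ?e then B w else 0)"
    define x where "x = (\<lambda>f. (1 - a) * s w f + a * y f)"
    note sw = statesD[OF nash(1) w(1)]
    have y: "y \<in> strategies G w" "own w y = c ?e * B w"
      using concentrated_strategy[OF w(1)] own_concentrated[OF w(2)] by (simp_all add: y_def)
    have "x \<in> strategies G w"
      unfolding strategies_def
    proof (intro CollectI conjI ballI)
      show "0 \<le> x f" if "f \<in> inc w" for f
        using strategies_nonneg[OF sw that] strategies_nonneg[OF y(1) that] a by (simp add: x_def)
      have "(\<Sum>f\<in>inc w. x f) = (1 - a) * (\<Sum>f\<in>inc w. s w f) + a * (\<Sum>f\<in>inc w. y f)"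
        by (simp add: x_def sum.distrib sum_distrib_left)
      also have "\<dots> \<le> (1 - a) * B w + a * B w"
        using sw y(1) a by (intro add_mono mult_left_mono) (auto simp: strategies_def)
      finally show "(\<Sum>f\<in>inc w. x f) \<le> B w" by (simp add: algebra_simps)
    qed
    moreover have "x ?e = s w ?e + d"
    proof -
      have "x ?e = s w ?e + a * (B w - s w ?e)" by (simp add: x_def y_def algebra_simps)
      then show ?thesis using d by (simp add: a_def)
    qed
    moreover have "own w x = own w (s w) - (top w - c ?e) * d"
    proof -
      have "own w x = (1 - a) * own w (s w) + a * own w y"
        by (simp add: own_def x_def distrib_left sum.distrib sum_distrib_left mult.left_commute)
      also have "\<dots> = own w (s w) - (top w - c ?e) * (a * B w)"
        using y(2) nash(2)[OF w(1)] by (simp add: algebra_simps)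
      also have "(top w - c ?e) * (a * B w) = (top w - c ?e) * d"
      proof (cases "c ?e = top w")
        case False
        then have "s w ?e = 0"
          using own_top_cheap[OF sw nash(2)[OF w(1)] w(2)] top_ge[OF w(2)] by simp
        then show ?thesis using d by (simp add: a_def)
      qed simp
      finally show ?thesis .
    qed
    ultimately show ?thesis by blast
  qed
  \<comment> \<open>The weights are crossed: \<open>u\<close> moves
    \<open>\<epsilon> * top v\<close> and \<open>v\<close> moves \<open>\<epsilon> * top u\<close>,
    which equalizes the two gains. The minimum keeps both amounts within the money not yet on the
    edge.\<close>
  define \<epsilon> where "\<epsilon> = min ((B u - s u ?e) / top v) ((B v - s v ?e) / top u)"
  have \<epsilon>: "0 < \<epsilon>" using gap top by (simp add: \<epsilon>_def)
  have le: "\<epsilon> * top v \<le> B u - s u ?e" "\<epsilon> * top u \<le> B v - s v ?e"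
    using top by (simp_all add: \<epsilon>_def flip: pos_le_divide_eq)
  obtain x where x: "x \<in> strategies G u" "own u x = own u (s u) - (top u - c ?e) * (\<epsilon> * top v)"
      "x ?e = s u ?e + \<epsilon> * top v"
    using shift[OF uv(1) inc(1) _ le(1) gap(1)] \<epsilon> top by auto
  obtain y where y: "y \<in> strategies G v" "own v y = own v (s v) - (top v - c ?e) * (\<epsilon> * top u)"
      "y ?e = s v ?e + \<epsilon> * top u"
    using shift[OF uv(2) inc(2) _ le(2) gap(2)] \<epsilon> top by auto
  let ?t = "s(u := x, v := y)"
  have t: "?t \<in> states G" by (intro states_update nash x y)
  have "received u ?t = received u s + c ?e * (\<epsilon> * top u)"
    using e uv(3) y(3) by (simp add: received_update[of u _ v] received_update_self)
  moreover have "received v ?t = received v s + c ?e * (\<epsilon> * top v)"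
    using e uv(3) x(3) by (simp add: received_update_self received_update[of v _ u] insert_commute)
  ultimately have "utility G ?t u - utility G s u = \<epsilon> * (c ?e * (top u + top v) - top u * top v)"
      "utility G ?t v - utility G s v = \<epsilon> * (c ?e * (top u + top v) - top u * top v)"
    using x(2) y(2) t nash(1) uv by (simp_all add: utility_eq algebra_simps)
  moreover have "0 < \<epsilon> * (c ?e * (top u + top v) - top u * top v)"
    using \<epsilon> contested by simp
  ultimately have "improving_bilateral_deviation G s u v x y"
    using uv x(1) y(1) by (simp add: improving_bilateral_deviation_def)
  then show False using eq by (auto simp: pairwise_equilibrium_def)
qed

text \<open>Purpose: the ends read off an equilibrium, each spending a positive budget entirely on
  its edge, are pairwise distinct nodes.\<close>

lemma two_full:
  assumes "x \<in> strategies G v" "e \<in> inc v" "f \<in> inc v" "e \<noteq> f" "x e = B v" "x f = B v"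
  shows "B v \<le> 0"
proof -
  have "x e + x f = (\<Sum>d\<in>{e, f}. x d)" using assms(4) by simp
  also have "\<dots> \<le> (\<Sum>d\<in>inc v. x d)"
    using assms by (intro sum_mono2) (auto simp: strategies_nonneg)
  also have "\<dots> \<le> B v" using assms(1) by (simp add: strategies_def)
  finally show ?thesis using assms(5,6) by simp
qed

text \<open>An improving pair shares an edge and both ends raise their contributions to it. A raise
  costs at least \<open>top - c\<close> per unit and is compensated only by \<open>c\<close> times
  the partner's raise; multiplying the two inequalities shows the edge to be contested, and an end
  with its whole budget there could not have raised anything.\<close>

lemma pairwise_equilibriumI:
  assumes nash: "nash_equilibrium G s"
    and contested: "\<And>u v. {u, v} \<in> E \<Longrightarrow> 0 < B u \<Longrightarrow> 0 < B v \<Longrightarrow>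
      top u * top v < c {u, v} * (top u + top v) \<Longrightarrow> s u {u, v} = B u \<or> s v {u, v} = B v"
  shows "pairwise_equilibrium G s"
  unfolding pairwise_equilibrium_def
proof (intro conjI nash notI, elim exE)
  fix u v x y
  assume dev: "improving_bilateral_deviation G s u v x y"
  let ?e = "{u, v}" and ?t = "s(u := x, v := y)"
  from dev have uv: "u \<in> V" "v \<in> V" "u \<noteq> v" and xy: "x \<in> strategies G u" "y \<in> strategies G v"
    and impr: "utility G ?t u > utility G s u" "utility G ?t v > utility G s v"
    by (auto simp: improving_bilateral_deviation_def)
  have s: "s \<in> states G" and own: "own u (s u) = top u * B u" "own v (s v) = top v * B v"
    using nash uv by (auto simp: nash_iff)
  have t: "?t \<in> states G" by (intro states_update s xy)
  have ru: "received u ?t = received u s + (if ?e \<in> E then c ?e * (y ?e - s v ?e) else 0)"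
    using uv(3) by (simp add: received_update[of u _ v] received_update_self)
  have rv: "received v ?t = received v s + (if ?e \<in> E then c ?e * (x ?e - s u ?e) else 0)"
    by (simp add: received_update_self received_update[of v _ u] insert_commute)
  have ine: "own u x + (if ?e \<in> E then c ?e * (y ?e - s v ?e) else 0) > top u * B u"
      "own v y + (if ?e \<in> E then c ?e * (x ?e - s u ?e) else 0) > top v * B v"
    using impr ru rv own uv s t by (simp_all add: utility_eq split: if_splits)
  \<comment> \<open>Without a common edge each player would face a unilateral deviation, which
    cannot beat the bound on \<open>own\<close>.\<close>
  have e: "?e \<in> E"
    using ine own_le[OF xy(1)] by (auto split: if_splits)
  have inc: "?e \<in> inc u" "?e \<in> inc v" using e by (auto simp: incident_edges_def)
  define dx dy where "dx = x ?e - s u ?e" and "dy = y ?e - s v ?e"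
  have pos: "0 < c ?e" using c_pos[OF e] .
  have "0 < c ?e * dx" "0 < c ?e * dy"
    using ine e own_le[OF xy(1)] own_le[OF xy(2)] by (simp_all add: dx_def dy_def)
  then have d: "0 < dx" "0 < dy" using pos by (simp_all add: zero_less_mult_iff)
  have s0: "0 \<le> s u ?e" "0 \<le> s v ?e"
    using s uv inc by (auto intro: strategies_nonneg[OF statesD])
  have xB: "x ?e \<le> B u" "y ?e \<le> B v"
    using strategies_le[OF xy(1) inc(1)] strategies_le[OF xy(2) inc(2)] by auto
  have tops: "c ?e \<le> top u" "c ?e \<le> top v" using top_ge inc by auto
  \<comment> \<open>The old contribution is nonnegative, so the raise is at most the new
    contribution, and the loss in \<open>own_le_split\<close> dominates the cost of the
    raise.\<close>
  have "(top u - c ?e) * dx \<le> (top u - c ?e) * x ?e" "(top v - c ?e) * dy \<le> (top v - c ?e) * y ?e"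
    using tops s0 by (auto intro!: mult_left_mono simp: dx_def dy_def)
  then have "(top u - c ?e) * dx < c ?e * dy" "(top v - c ?e) * dy < c ?e * dx"
    using ine e own_le_split[OF xy(1) inc(1)] own_le_split[OF xy(2) inc(2)]
    unfolding dx_def[symmetric] dy_def[symmetric] if_P[OF e] by linarith+
  \<comment> \<open>Both left-hand sides are nonnegative, so the inequalities may be multiplied;
    afterwards \<open>dx * dy\<close> cancels, and \<open>c ?e * c ?e\<close> drops out on
    expansion.\<close>
  then have "((top u - c ?e) * dx) * ((top v - c ?e) * dy) < (c ?e * dy) * (c ?e * dx)"
    by (rule mult_strict_mono') (use tops d in simp_all)
  then have "((top u - c ?e) * (top v - c ?e)) * (dx * dy) < (c ?e * c ?e) * (dx * dy)"
    by (simp only: ac_simps)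
  then have "(top u - c ?e) * (top v - c ?e) < c ?e * c ?e"
    using d by (meson mult_less_cancel_right_pos mult_pos_pos)
  then have "top u * top v < c ?e * (top u + top v)"
    by (simp add: algebra_simps)
  \<comment> \<open>The deviation itself shows that the budgets are positive: \<open>0 < dx\<close>
    and \<open>0 \<le> s u ?e\<close> give \<open>0 < x ?e \<le> B u\<close>, and likewise for
    \<open>v\<close>.\<close>
  then have "s u ?e = B u \<or> s v ?e = B v"
    using contested[OF e] d s0 xB by (simp add: dx_def dy_def)
  then show False using d xB by (auto simp: dx_def dy_def)
qed

lemma concentrated_equilibrium:
  assumes best: "\<And>v. v \<in> V \<Longrightarrow> inc v \<noteq> {} \<Longrightarrow> g v \<in> inc v \<and> c (g v) = top v"
    and contested: "\<And>u v. {u, v} \<in> E \<Longrightarrow> 0 < B u \<Longrightarrow> 0 < B v \<Longrightarrow>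
      top u * top v < c {u, v} * (top u + top v) \<Longrightarrow> g u = {u, v} \<or> g v = {u, v}"
  shows "pairwise_equilibrium G (\<lambda>v e. if e = g v then B v else 0)"
proof (rule pairwise_equilibriumI)
  have "own v (\<lambda>e. if e = g v then B v else 0) = top v * B v" if "v \<in> V" for v
  proof (cases "inc v = {}")
    case True
    then show ?thesis by (simp add: own_def top_def)
  next
    case False
    with best[OF that] show ?thesis by (simp add: own_concentrated)
  qed
  then show "nash_equilibrium G (\<lambda>v e. if e = g v then B v else 0)"
    by (auto simp: nash_iff states_def concentrated_strategy)
qed (use contested in fastforce)

end

section \<open>Price of anarchy\<close>

lemma linear_gamesE:
  assumes "G \<in> linear_games" obtains c where "linear_game G c"
  using assms by (auto simp: linear_games_def linear_game_def)

lemma linear_game_optimum: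
  assumes "G \<in> linear_games" "pairwise_equilibrium G s"
  shows "social_optimum G s" and "social_optimum G t \<Longrightarrow> welfare G s = welfare G t"
proof -
  from assms obtain c where "linear_game G c" by (blast elim: linear_gamesE)
  then interpret linear_game G c .
  have "nash_equilibrium G s" using assms by (simp add: pairwise_equilibrium_def)
  then show opt: "social_optimum G s"
    by (simp add: social_optimum_def nash_optimal nash_iff)
  show "welfare G s = welfare G t" if "social_optimum G t"
    using that opt by (simp add: social_optimum_def order_antisym)
qed

lemma class_price_of_anarchy_linear: "class_price_of_anarchy (linear_games :: 'v game set) = 1"
proof -
  have "price_of_anarchy G = 1"
    if G: "(G :: 'v game) \<in> linear_games" and s: "pairwise_equilibrium G s" for G s
  proof -
    have "welfare_ratio (welfare G t) (welfare G s) = 1"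
      if "pairwise_equilibrium G s" "social_optimum G t" for s t
      using linear_game_optimum(2)[OF G that] by (simp add: welfare_ratio_def one_ereal_def)
    \<comment> \<open>The set is nonempty because the equilibrium \<open>s\<close> is itself a
      social optimum.\<close>
    then have "{welfare_ratio (welfare G t) (welfare G s) | s t.
        pairwise_equilibrium G s \<and> social_optimum G t} = {1}"
      using s linear_game_optimum(1)[OF G s] by (auto intro!: exI[of _ s])
    then show ?thesis by (simp add: price_of_anarchy_def)
  qed
  \<comment> \<open>The empty game exists over every node type and shows that some game of the class
    has an equilibrium; the supremum of the empty set would be \<open>-\<infinity>\<close>.\<close>
  moreover define G0 :: "'v game"
    where "G0 = \<lparr>nodes = {}, edges = {}, budget = \<lambda>_. 0, reward = \<lambda>_ _ _. 0\<rparr>"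
  have "G0 \<in> linear_games"
    by (simp add: linear_games_def contribution_game_def G0_def)
  moreover have "pairwise_equilibrium G0 (\<lambda>_ _. 0)"
    by (simp add: pairwise_equilibrium_def nash_equilibrium_def states_def
        improving_bilateral_deviation_def G0_def)
  ultimately have "price_of_anarchy ` {G \<in> linear_games :: 'v game set. \<exists>s. pairwise_equilibrium G s} = {1}"
    by (auto simp: image_iff) (metis)
  then show ?thesis by (simp add: class_price_of_anarchy_def)
qed

section \<open>Polynomial-time loop programs\<close>

text \<open>Only counting loops: \<open>Loop k l c\<close> repeats \<open>c\<close> with its counter
  in cell 0 of array \<open>k\<close> and its bound in input cell \<open>l\<close>. Every program
  terminates, so its meaning is a total function \<open>run\<close>.\<close>

datatype prog =
    Nop
  | Store nat aexp aexp
  | Then prog prog (infixr ";;" 60)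
  | Choose bexp prog prog
  | Loop nat nat prog

primrec compile :: "prog \<Rightarrow> com" where
  "compile Nop = Skip"
| "compile (Store a i x) = Assign a i x"
| "compile (c ;; d) = Seq (compile c) (compile d)"
| "compile (Choose b c d) = Cond b (compile c) (compile d)"
| "compile (Loop k l c) =
     Seq (Assign k (Num 0) (Num 0))
       (While (Less (Cell k (Num 0)) (Cell 0 (Num l)))
         (Seq (compile c) (Assign k (Num 0) (Plus (Cell k (Num 0)) (Num 1)))))"

definition increment :: "nat \<Rightarrow> memory \<Rightarrow> memory" where
  "increment k \<sigma> = \<sigma>(k := (\<sigma> k)(0 := Suc (\<sigma> k 0)))"

primrec run :: "prog \<Rightarrow> memory \<Rightarrow> memory" where
  "run Nop \<sigma> = \<sigma>"
| "run (Store a i x) \<sigma> = \<sigma>(a := (\<sigma> a)(aval i \<sigma> := aval x \<sigma>))"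
| "run (c ;; d) \<sigma> = run d (run c \<sigma>)"
| "run (Choose b c d) \<sigma> = (if bval b \<sigma> then run c \<sigma> else run d \<sigma>)"
| "run (Loop k l c) \<sigma> = ((\<lambda>\<tau>. increment k (run c \<tau>)) ^^ \<sigma> 0 l) (\<sigma>(k := (\<sigma> k)(0 := 0)))"

primrec writes :: "prog \<Rightarrow> nat set" where
  "writes Nop = {}"
| "writes (Store a i x) = {a}"
| "writes (c ;; d) = writes c \<union> writes d"
| "writes (Choose b c d) = writes c \<union> writes d"
| "writes (Loop k l c) = insert k (writes c)"

text \<open>Stored values are constants up to 2 or copies of cells, so that no store creates a
  longer number; arithmetic remains available in indices and tests.\<close>

fun copied :: "aexp \<Rightarrow> bool" where
  "copied (Num k) \<longleftrightarrow> k \<le> 2"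
| "copied (Cell a i) \<longleftrightarrow> True"
| "copied _ \<longleftrightarrow> False"

text \<open>Array 0 is read-only, so loop bounds never change; they are the input cells 1 and 2,
  which hold the numbers of nodes and links. A body leaves the counter of its loop alone, so nested
  loops use different counters.\<close>

primrec admissible :: "prog \<Rightarrow> bool" where
  "admissible Nop \<longleftrightarrow> True"
| "admissible (Store a i x) \<longleftrightarrow> a \<noteq> 0 \<and> copied x"
| "admissible (c ;; d) \<longleftrightarrow> admissible c \<and> admissible d"
| "admissible (Choose b c d) \<longleftrightarrow> admissible c \<and> admissible d"
| "admissible (Loop k l c) \<longleftrightarrow> k \<noteq> 0 \<and> l \<in> {1, 2} \<and> k \<notin> writes c \<and> admissible c"

lemma run_unwritten: "a \<notin> writes c \<Longrightarrow> run c \<sigma> a = \<sigma> a"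
proof (induction c arbitrary: \<sigma>)
  case (Loop k l c)
  have "((\<lambda>\<tau>. increment k (run c \<tau>)) ^^ j) \<rho> a = \<rho> a" for j \<rho>
    by (induction j) (use Loop in \<open>auto simp: increment_def\<close>)
  then show ?case using Loop.prems by simp
qed auto

lemma admissible_keeps_input: "admissible c \<Longrightarrow> 0 \<notin> writes c"
  by (induction c) auto

lemma loop_state:
  fixes \<sigma> :: memory
  assumes "admissible (Loop k l c)"
  defines "\<rho> \<equiv> \<lambda>j. ((\<lambda>\<tau>. increment k (run c \<tau>)) ^^ j) (\<sigma>(k := (\<sigma> k)(0 := 0)))"
  shows "\<rho> j k 0 = j" and "a \<notin> writes c \<Longrightarrow> a \<noteq> k \<Longrightarrow> \<rho> j a = \<sigma> a"
proof -
  show "\<rho> j k 0 = j"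
    using assms by (induction j) (auto simp: increment_def run_unwritten)
  show "\<rho> j a = \<sigma> a" if "a \<notin> writes c" "a \<noteq> k"
    using that by (induction j) (auto simp: \<rho>_def increment_def run_unwritten)
qed

text \<open>The loop rule used throughout. A step may also assume that the counter holds
  \<open>j\<close> and that arrays not written by the body are as before the loop; the increment of
  the counter is an explicit update.\<close>

lemma run_Loop_invariant:
  assumes adm: "admissible (Loop k l c)"
    and init: "Inv 0 (\<sigma>(k := (\<sigma> k)(0 := 0)))"
    and step: "\<And>j \<tau>. j < \<sigma> 0 l \<Longrightarrow> \<tau> k 0 = j \<Longrightarrow> (\<And>a. a \<notin> writes c \<Longrightarrow> a \<noteq> k \<Longrightarrow> \<tau> a = \<sigma> a) \<Longrightarrow>
      Inv j \<tau> \<Longrightarrow> Inv (Suc j) ((run c \<tau>)(k := (\<tau> k)(0 := Suc j)))"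
  shows "Inv (\<sigma> 0 l) (run (Loop k l c) \<sigma>)"
proof -
  let ?\<rho> = "\<lambda>j. ((\<lambda>\<tau>. increment k (run c \<tau>)) ^^ j) (\<sigma>(k := (\<sigma> k)(0 := 0)))"
  have "j \<le> \<sigma> 0 l \<Longrightarrow> Inv j (?\<rho> j)" for j
  proof (induction j)
    case (Suc j)
    have "run c (?\<rho> j) k = ?\<rho> j k"
      using adm by (intro run_unwritten) simp
    then have "?\<rho> (Suc j) = (run c (?\<rho> j))(k := (?\<rho> j k)(0 := Suc j))"
      using loop_state(1)[OF adm, where \<sigma> = \<sigma> and j = j] by (simp add: increment_def)
    with step[of j "?\<rho> j"] Suc loop_state[OF adm, where \<sigma> = \<sigma> and j = j] show ?case
      by (simp del: funpow.simps fun_upd_apply)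
  qed (use init in simp)
  then show ?thesis by simp
qed

section \<open>Cost bounds for compiled programs\<close>

primrec awidth :: "aexp \<Rightarrow> nat" where
  "awidth (Num k) = Suc k"
| "awidth (Cell a i) = 1"
| "awidth (Plus x y) = Suc (awidth x + awidth y)"
| "awidth (Minus x y) = awidth x"
| "awidth (Times x y) = awidth x + awidth y"

primrec aweight :: "aexp \<Rightarrow> nat" where
  "aweight (Num k) = Suc k"
| "aweight (Cell a i) = aweight i + 1"
| "aweight (Plus x y) = aweight x + aweight y + awidth (Plus x y)"
| "aweight (Minus x y) = aweight x + aweight y + awidth (Minus x y)"
| "aweight (Times x y) = aweight x + aweight y + awidth (Times x y)"

primrec bweight :: "bexp \<Rightarrow> nat" where
  "bweight (Less x y) = aweight x + aweight y"
| "bweight (Equal x y) = aweight x + aweight y"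
| "bweight (Neg b) = Suc (bweight b)"
| "bweight (Conj b c) = Suc (bweight b + bweight c)"

text \<open>The parameter \<open>L\<close> bounds both the bit lengths of cells and the numbers of
  iterations. In a loop, the summand 2 of \<open>w\<close> pays for resetting the counter.\<close>

primrec cost :: "prog \<Rightarrow> nat \<Rightarrow> nat" where
  "cost Nop L = 1"
| "cost (Store a i x) L = (aweight i + aweight x) * L"
| "cost (c ;; d) L = cost c L + cost d L"
| "cost (Choose b c d) L = bweight b * L + cost c L + cost d L"
| "cost (Loop k l c) L = (let w = 2 + bweight (Less (Cell k (Num 0)) (Cell 0 (Num l))) in
     w * L + L * (cost c L + (w + aweight (Num 0) + aweight (Plus (Cell k (Num 0)) (Num 1))) * L))"

text \<open>\<open>2 \<le> L\<close> lets the constant 2 fit under \<open>2 ^ L\<close>; input cells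
  1 and 2 are the possible loop bounds and are therefore bounded in value, not only in
  length.\<close>

definition below :: "nat \<Rightarrow> memory \<Rightarrow> bool" where
  "below L \<sigma> \<longleftrightarrow> 2 \<le> L \<and> (\<forall>a i. \<sigma> a i < 2 ^ L) \<and> \<sigma> 0 1 \<le> L \<and> \<sigma> 0 2 \<le> L"

lemma bit_length_le: "k < 2 ^ p \<Longrightarrow> 1 \<le> p \<Longrightarrow> bit_length k \<le> p"
proof (cases "k = 0")
  case False
  assume "k < 2 ^ p"
  moreover have "2 ^ floor_log k \<le> k" using False by (simp add: floor_log_exp2_le)
  ultimately have "(2::nat) ^ floor_log k < 2 ^ p" by linarith
  then have "floor_log k < p" by simp
  then show ?thesis by (simp add: bit_length_def)
qed (simp add: bit_length_def)

text \<open>Products add widths, a sum needs one extra bit, and a cell has width 1 whatever its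
  index. For a fixed expression the width is a constant factor.\<close>

lemma aval_less: "below L \<sigma> \<Longrightarrow> aval x \<sigma> < 2 ^ (awidth x * L)"
proof (induction x)
  case (Num k)
  have "k < 2 ^ k" by simp
  also have "(2::nat) ^ k \<le> 2 ^ (Suc k * L)"
    using mult_le_mono[of k "Suc k" 1 L] Num by (intro power_increasing) (auto simp: below_def)
  finally show ?case by simp
next
  case (Plus x y)
  have "aval x \<sigma> < 2 ^ (awidth x * L + awidth y * L)" "aval y \<sigma> < 2 ^ (awidth x * L + awidth y * L)"
    using Plus by (metis less_le_trans le_add1 le_add2 power_increasing one_le_numeral)+
  then have "aval x \<sigma> + aval y \<sigma> < 2 ^ Suc (awidth x * L + awidth y * L)"
    by simp
  also have "(2::nat) ^ Suc (awidth x * L + awidth y * L) \<le> 2 ^ (awidth (Plus x y) * L)"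
    using Plus.prems by (intro power_increasing) (auto simp: below_def algebra_simps)
  finally show ?case by simp
next
  case (Times x y)
  then have "aval x \<sigma> * aval y \<sigma> < 2 ^ (awidth x * L) * 2 ^ (awidth y * L)"
    by (intro mult_strict_mono) auto
  then show ?case by (simp add: power_add algebra_simps)
qed (auto simp: below_def intro: le_less_trans[OF diff_le_self])

lemma awidth_pos: "1 \<le> awidth x"
  by (induction x) auto

lemma bit_length_aval: "below L \<sigma> \<Longrightarrow> bit_length (aval x \<sigma>) \<le> awidth x * L"
  by (rule bit_length_le[OF aval_less]) (use awidth_pos[of x] in \<open>auto simp: below_def\<close>)

lemma acost_le: "below L \<sigma> \<Longrightarrow> acost x \<sigma> \<le> aweight x * L"
proof (induction x)
  case (Num k)
  then show ?case using bit_length_aval[of L \<sigma> "Num k"] by simp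
next
  case (Cell a i)
  then show ?case using bit_length_aval[of L \<sigma> "Cell a i"] by (simp add: algebra_simps)
next
  case (Plus x y)
  then show ?case using bit_length_aval[of L \<sigma> "Plus x y"] by (simp add: algebra_simps)
next
  case (Minus x y)
  then show ?case using bit_length_aval[of L \<sigma> "Minus x y"] by (simp add: algebra_simps)
next
  case (Times x y)
  then show ?case using bit_length_aval[of L \<sigma> "Times x y"] by (simp add: algebra_simps)
qed

lemma bcost_le: "below L \<sigma> \<Longrightarrow> bcost b \<sigma> \<le> bweight b * L"
proof (induction b)
  case (Less x y)
  then show ?case using acost_le[of L \<sigma> x] acost_le[of L \<sigma> y] by (simp add: algebra_simps)
next
  case (Equal x y)
  then show ?case using acost_le[of L \<sigma> x] acost_le[of L \<sigma> y] by (simp add: algebra_simps)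
qed (auto simp: below_def add_mult_distrib)

lemma below_update:
  "below L \<sigma> \<Longrightarrow> a \<noteq> 0 \<Longrightarrow> x < 2 ^ L \<Longrightarrow> below L (\<sigma>(a := (\<sigma> a)(i := x)))"
  by (auto simp: below_def)

lemma below_copied: "below L \<sigma> \<Longrightarrow> copied x \<Longrightarrow> aval x \<sigma> < 2 ^ L"
proof (cases x)
  case (Num k)
  assume "below L \<sigma>" "copied x"
  then have "k \<le> 2" "2 \<le> L"
    using Num by (auto simp: below_def)
  moreover from this(2) have "(2::nat) ^ 2 \<le> 2 ^ L" by (intro power_increasing) auto
  ultimately show ?thesis using Num by simp
qed (auto simp: below_def)

text \<open>\<open>below L\<close> survives every step, because only copies, small constants and
  counters up to the loop bound are written. One \<open>L\<close> thus serves the whole run, and the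
  cost estimate follows the structure of the program.\<close>

lemma compile_correct:
  assumes "admissible c" and "below L \<sigma>"
  shows "\<exists>t. exec (compile c) \<sigma> t (run c \<sigma>) \<and> t \<le> cost c L \<and> below L (run c \<sigma>)"
  using assms
proof (induction c arbitrary: \<sigma>)
  case Nop
  then show ?case by (auto intro: exec.Skip)
next
  case (Store a i x)
  have "acost i \<sigma> + acost x \<sigma> \<le> (aweight i + aweight x) * L"
    using acost_le[OF Store.prems(2), of i] acost_le[OF Store.prems(2), of x]
    by (simp add: algebra_simps)
  moreover have "below L (\<sigma>(a := (\<sigma> a)(aval i \<sigma> := aval x \<sigma>)))"
    using Store.prems by (intro below_update below_copied) auto
  ultimately show ?case
    using exec.Assign[of a i x \<sigma>] unfolding compile.simps run.simps cost.simps by blast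
next
  case (Then c d)
  then obtain t where t: "exec (compile c) \<sigma> t (run c \<sigma>)" "t \<le> cost c L" "below L (run c \<sigma>)"
    by auto
  with Then obtain t' where "exec (compile d) (run c \<sigma>) t' (run d (run c \<sigma>))"
      "t' \<le> cost d L" "below L (run d (run c \<sigma>))"
    by force
  with t show ?case by (auto intro!: exI[of _ "t + t'"] intro: exec.Seq)
next
  case (Choose b c d)
  note b = bcost_le[OF Choose.prems(2), of b]
  show ?case
  proof (cases "bval b \<sigma>")
    case True
    with Choose obtain t where t: "exec (compile c) \<sigma> t (run c \<sigma>)" "t \<le> cost c L" "below L (run c \<sigma>)"
      by auto
    have "exec (compile (Choose b c d)) \<sigma> (bcost b \<sigma> + t) (run c \<sigma>)"
      using True t by (auto intro: exec.CondTrue)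
    with t b True show ?thesis by (auto intro!: exI[of _ "bcost b \<sigma> + t"])
  next
    case False
    with Choose obtain t where t: "exec (compile d) \<sigma> t (run d \<sigma>)" "t \<le> cost d L" "below L (run d \<sigma>)"
      by auto
    have "exec (compile (Choose b c d)) \<sigma> (bcost b \<sigma> + t) (run d \<sigma>)"
      using False t by (auto intro: exec.CondFalse)
    with t b False show ?thesis by (auto intro!: exI[of _ "bcost b \<sigma> + t"])
  qed
next
  case (Loop k l c)
  let ?test = "Less (Cell k (Num 0)) (Cell 0 (Num l))"
  let ?inc = "Assign k (Num 0) (Plus (Cell k (Num 0)) (Num 1))"
  let ?W = "While ?test (Seq (compile c) ?inc)"
  let ?\<rho> = "\<lambda>j. ((\<lambda>\<tau>. increment k (run c \<tau>)) ^^ j) (\<sigma>(k := (\<sigma> k)(0 := 0)))"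
  define N where "N = \<sigma> 0 l"
  define T where "T = bweight ?test * L"
  define S where "S = T + cost c L + (aweight (Num 0) + aweight (Plus (Cell k (Num 0)) (Num 1))) * L"
  have L: "N \<le> L" "N < 2 ^ L" "2 \<le> L"
    using Loop.prems by (auto simp: N_def below_def)
  have adm: "admissible c" "k \<noteq> 0" "k \<notin> writes c" "0 \<notin> writes c"
    using Loop.prems by (auto simp: admissible_keeps_input)
  have counter: "?\<rho> j k 0 = j" and limit: "?\<rho> j 0 l = N" for j
    using loop_state[OF Loop.prems(1), where \<sigma> = \<sigma> and j = j] adm unfolding N_def by auto
  have step: "\<exists>t. exec (Seq (compile c) ?inc) (?\<rho> j) t (?\<rho> (Suc j)) \<and> T + t \<le> S \<and> below L (?\<rho> (Suc j))"
    if "below L (?\<rho> j)" "j < N" for j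
  proof -
    from Loop.IH[OF adm(1) that(1)] obtain t where
      t: "exec (compile c) (?\<rho> j) t (run c (?\<rho> j))" "t \<le> cost c L" "below L (run c (?\<rho> j))"
      by blast
    let ?\<tau> = "run c (?\<rho> j)"
    have k: "?\<tau> k 0 = j"
      using counter adm by (simp add: run_unwritten)
    have inc: "exec ?inc ?\<tau> (acost (Num 0) ?\<tau> + acost (Plus (Cell k (Num 0)) (Num 1)) ?\<tau>) (?\<rho> (Suc j))"
      using exec.Assign[of k "Num 0" "Plus (Cell k (Num 0)) (Num 1)" ?\<tau>] by (simp add: increment_def)
    moreover have "acost (Num 0) ?\<tau> + acost (Plus (Cell k (Num 0)) (Num 1)) ?\<tau> \<le>
        (aweight (Num 0) + aweight (Plus (Cell k (Num 0)) (Num 1))) * L"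
      using acost_le[OF t(3), of "Num 0"] acost_le[OF t(3), of "Plus (Cell k (Num 0)) (Num 1)"]
      by (simp only: add_mult_distrib)
    moreover have "below L (?\<rho> (Suc j))"
      using below_update[OF t(3) adm(2), of "Suc j" 0] k that(2) L by (simp add: increment_def)
    ultimately show ?thesis
      using exec.Seq[OF t(1) inc] t(2) unfolding S_def
      by (intro exI[of _ "t + (acost (Num 0) ?\<tau> + acost (Plus (Cell k (Num 0)) (Num 1)) ?\<tau>)"]) linarith
  qed
  have init: "below L (?\<rho> 0)"
    using below_update[OF Loop.prems(2) adm(2)] by simp
  have below: "j \<le> N \<Longrightarrow> below L (?\<rho> j)" for j
    by (induction j) (use init step in \<open>force+\<close>)
  have test: "bcost ?test (?\<rho> j) \<le> T" if "j \<le> N" for j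
    unfolding T_def by (rule bcost_le[OF below[OF that]])
  \<comment> \<open>\<open>d\<close> counts the iterations still to come, since the rules of
    \<open>While\<close> peel off the first iteration.\<close>
  have "d \<le> N \<Longrightarrow> \<exists>t. exec ?W (?\<rho> (N - d)) t (?\<rho> N) \<and> t \<le> T + d * S" for d
  proof (induction d)
    case 0
    have "\<not> bval ?test (?\<rho> N)" by (simp only: bval.simps aval.simps counter limit)
    then have "exec ?W (?\<rho> N) (bcost ?test (?\<rho> N)) (?\<rho> N)" by (rule exec.WhileFalse)
    then show ?case using test[of N] by (simp del: fun_upd_apply bcost.simps) blast
  next
    case (Suc d)
    let ?j = "N - Suc d"
    have j: "Suc ?j = N - d" "?j < N" using Suc.prems by auto
    have b: "bval ?test (?\<rho> ?j)" using j(2) by (simp only: bval.simps aval.simps counter limit)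
    from step[OF below j(2)] j obtain t where
      t: "exec (Seq (compile c) ?inc) (?\<rho> ?j) t (?\<rho> (N - d))" "T + t \<le> S"
      by (metis less_imp_le)
    from Suc.IH[OF Suc_leD[OF Suc.prems]]
    obtain t' where t': "exec ?W (?\<rho> (N - d)) t' (?\<rho> N)" "t' \<le> T + d * S" by blast
    have "exec ?W (?\<rho> ?j) (bcost ?test (?\<rho> ?j) + t + t') (?\<rho> N)"
      by (rule exec.WhileTrue[OF b t(1) t'(1)])
    moreover have "bcost ?test (?\<rho> ?j) + t + t' \<le> T + Suc d * S"
      using test[of ?j] t(2) t'(2) by simp
    ultimately show ?case by blast
  qed
  from this[of N] obtain t where t: "exec ?W (?\<rho> 0) t (?\<rho> N)" "t \<le> T + N * S"
    unfolding diff_self_eq_0 by blast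
  have "exec (Assign k (Num 0) (Num 0)) \<sigma> 2 (?\<rho> 0)"
    using exec.Assign[of k "Num 0" "Num 0" \<sigma>] by (simp add: bit_length_def numeral_2_eq_2)
  from exec.Seq[OF this t(1)] have "exec (compile (Loop k l c)) \<sigma> (2 + t) (run (Loop k l c) \<sigma>)"
    by (simp add: N_def)
  moreover have "2 + t \<le> cost (Loop k l c) L"
  proof -
    have "2 + t \<le> 2 * L + T + L * S"
      using t(2) L mult_le_mono1[OF L(1), of S] by linarith
    also have "\<dots> \<le> cost (Loop k l c) L"
      by (simp add: T_def S_def Let_def algebra_simps)
    finally show ?thesis .
  qed
  moreover have "below L (run (Loop k l c) \<sigma>)"
    using below[of N] by (simp add: N_def)
  ultimately show ?case by blast
qed

lemma cost_polynomial: "\<exists>p :: nat poly. \<forall>L. cost c L = poly p L"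
proof (induction c)
  case Nop
  show ?case by (intro exI[of _ 1]) simp
next
  case (Store a i x)
  show ?case by (intro exI[of _ "[:0, aweight i + aweight x:]"]) simp
next
  case (Then c d)
  then obtain p q where "\<forall>L. cost c L = poly p L" "\<forall>L. cost d L = poly q L" by blast
  then show ?case by (intro exI[of _ "p + q"]) simp
next
  case (Choose b c d)
  then obtain p q where "\<forall>L. cost c L = poly p L" "\<forall>L. cost d L = poly q L" by blast
  then show ?case by (intro exI[of _ "[:0, bweight b:] + p + q"]) simp
next
  case (Loop k l c)
  then obtain p where "\<forall>L. cost c L = poly p L" by blast
  moreover obtain v w where "\<And>L. cost (Loop k l c) L = v * L + L * (cost c L + w * L)"
    unfolding cost.simps Let_def by (metis mult.commute)
  ultimately show ?case
    by (intro exI[of _ "[:0, v:] + [:0, 1:] * (p + [:0, w:])"]) (simp add: algebra_simps)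
qed

section \<open>Choosing an end for every contested link\<close>

text \<open>The 2-satisfiability problem in abstract form. A link \<open>e < m\<close> has a value
  \<open>T e\<close>: 0 for undecided, 1 or 2 for the chosen end. \<open>target e x\<close> is the
  node at end \<open>x\<close>, which no two links may share, and \<open>ok e x\<close> says that
  this end is permitted.\<close>

locale two_choice =
  fixes m :: nat and req :: "nat \<Rightarrow> bool" and target :: "nat \<Rightarrow> nat \<Rightarrow> nat"
    and ok :: "nat \<Rightarrow> nat \<Rightarrow> bool"
begin

definition partial :: "(nat \<Rightarrow> nat) \<Rightarrow> bool" where
  "partial T \<longleftrightarrow> (\<forall>e<m. T e \<le> 2 \<and> (T e \<noteq> 0 \<longrightarrow> req e))"

definition conflict_free :: "(nat \<Rightarrow> nat) \<Rightarrow> bool" where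
  "conflict_free T \<longleftrightarrow> (\<forall>e<m. T e \<noteq> 0 \<longrightarrow> ok e (T e) \<and>
     (\<forall>f<m. e \<noteq> f \<longrightarrow> T f \<noteq> 0 \<longrightarrow> target e (T e) \<noteq> target f (T f)))"

definition solution :: "(nat \<Rightarrow> nat) \<Rightarrow> bool" where
  "solution T \<longleftrightarrow> partial T \<and> conflict_free T \<and> (\<forall>e<m. req e \<longrightarrow> T e \<noteq> 0)"

text \<open>The node chosen by \<open>e\<close> is taken, so the undecided link \<open>f\<close>
  with an end there is left with its other end only.\<close>

definition hits :: "(nat \<Rightarrow> nat) \<Rightarrow> nat \<Rightarrow> nat \<Rightarrow> bool" where
  "hits T e f \<longleftrightarrow> e \<noteq> f \<and> T e \<noteq> 0 \<and> req f \<and> T f = 0 \<and>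
     (target e (T e) = target f 1 \<or> target e (T e) = target f 2)"

definition closed :: "(nat \<Rightarrow> nat) \<Rightarrow> bool" where
  "closed T \<longleftrightarrow> (\<forall>e<m. \<forall>f<m. \<not> hits T e f)"

definition agrees :: "(nat \<Rightarrow> nat) \<Rightarrow> (nat \<Rightarrow> nat) \<Rightarrow> bool" where
  "agrees T t \<longleftrightarrow> (\<forall>e<m. T e \<noteq> 0 \<longrightarrow> t e = T e)"

definition force :: "nat \<Rightarrow> nat \<Rightarrow> (nat \<Rightarrow> nat) \<Rightarrow> nat \<Rightarrow> nat" where
  "force e f T = (if hits T e f then T(f := if target e (T e) = target f 1 then 2 else 1) else T)"

text \<open>Soundness of forcing as one transitive relation: decisions persist and no solution
  extending \<open>T\<close> is lost. The last clause makes further sweeps of a closed assignment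
  harmless.\<close>

definition derives :: "(nat \<Rightarrow> nat) \<Rightarrow> (nat \<Rightarrow> nat) \<Rightarrow> bool" where
  "derives T T' \<longleftrightarrow> agrees T T' \<and> (partial T \<longrightarrow> partial T') \<and>
     (\<forall>t. solution t \<longrightarrow> agrees T t \<longrightarrow> agrees T' t) \<and> (closed T \<longrightarrow> T' = T)"

definition assigned :: "(nat \<Rightarrow> nat) \<Rightarrow> nat set" where
  "assigned T = {e. e < m \<and> T e \<noteq> 0}"

lemma conflict_freeD:
  "conflict_free T \<Longrightarrow> e < m \<Longrightarrow> f < m \<Longrightarrow> e \<noteq> f \<Longrightarrow> T e \<noteq> 0 \<Longrightarrow> T f \<noteq> 0 \<Longrightarrow>
    target e (T e) \<noteq> target f (T f)"
  by (simp add: conflict_free_def)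

lemma derives_refl: "derives T T"
  by (simp add: derives_def agrees_def)

lemma derives_trans: "derives T T' \<Longrightarrow> derives T' T'' \<Longrightarrow> derives T T''"
  by (simp add: derives_def agrees_def)

lemma derives_assigned: "derives T T' \<Longrightarrow> f < m \<Longrightarrow> T f \<noteq> 0 \<Longrightarrow> T' f = T f"
  by (auto simp: derives_def agrees_def)

text \<open>A solution agreeing with \<open>T\<close> shares the decision on \<open>e\<close> and
  must decide the required \<open>f\<close> without reusing that node, so it takes the forced
  end.\<close>

lemma derives_force:
  assumes "e < m" "f < m" shows "derives T (force e f T)"
  unfolding derives_def
proof (intro conjI allI impI)
  show "agrees T (force e f T)" by (auto simp: agrees_def force_def hits_def)
  show "partial (force e f T)" if "partial T"
    using that by (auto simp: partial_def force_def hits_def)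
  show "force e f T = T" if "closed T"
    using that assms by (auto simp: closed_def force_def)
  fix t assume t: "solution t" "agrees T t"
  show "agrees (force e f T) t"
  proof (cases "hits T e f")
    case True
    then have "t e = T e" "t e \<noteq> 0" "t f \<noteq> 0" "e \<noteq> f" "t f \<le> 2"
      using t assms by (auto simp: solution_def hits_def agrees_def partial_def)
    moreover have "target e (t e) \<noteq> target f (t f)"
      using t(1) calculation assms by (intro conflict_freeD) (simp_all add: solution_def)
    moreover have "t f = 1 \<or> t f = 2" using \<open>t f \<noteq> 0\<close> \<open>t f \<le> 2\<close> by linarith
    ultimately have "t f = (if target e (T e) = target f 1 then 2 else 1)"
      using True by (auto simp: hits_def)
    then show ?thesis using t(2) True by (auto simp: agrees_def force_def)
  qed (use t in \<open>simp add: force_def\<close>)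
qed

lemma force_hit: "hits T e f \<Longrightarrow> force e f T f \<noteq> 0"
  by (simp add: force_def)

text \<open>Progress measure: handling all hits of an assignment that is not closed decides at least
  one new link, so \<open>m\<close> rounds reach a closed one.\<close>

lemma assigned_grows:
  assumes d: "derives T T'" and cover: "\<And>e f. e < m \<Longrightarrow> f < m \<Longrightarrow> hits T e f \<Longrightarrow> T' f \<noteq> 0"
    and r: "closed T \<or> r \<le> card (assigned T)"
  shows "closed T' \<or> Suc r \<le> card (assigned T')"
proof (cases "closed T")
  case True
  with d show ?thesis by (simp add: derives_def)
next
  case False
  then obtain e f where ef: "e < m" "f < m" "hits T e f" unfolding closed_def by blast
  have "assigned T \<subseteq> assigned T'"
    using derives_assigned[OF d] by (auto simp: assigned_def)
  moreover have "f \<in> assigned T' - assigned T"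
    using ef cover[OF ef] by (simp add: assigned_def hits_def)
  ultimately have "assigned T \<subset> assigned T'" by blast
  then have "card (assigned T) < card (assigned T')"
    by (intro psubset_card_mono) (simp add: assigned_def)
  with r False show ?thesis by simp
qed

lemma closed_if_all_assigned:
  assumes "m \<le> card (assigned T)" shows "closed T"
proof -
  have "assigned T = {..<m}"
  proof (rule card_subset_eq)
    show sub: "assigned T \<subseteq> {..<m}" by (auto simp: assigned_def)
    show "card (assigned T) = card {..<m}"
      using assms card_mono[OF finite_lessThan sub] by simp
  qed simp
  then have "\<forall>f<m. T f \<noteq> 0" unfolding assigned_def by blast
  then show ?thesis by (simp add: closed_def hits_def)
qed

lemma solution_values: "solution t \<Longrightarrow> e < m \<Longrightarrow> t e \<noteq> 0 \<Longrightarrow> t e = 1 \<or> t e = 2"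
  unfolding solution_def partial_def by (metis One_nat_def le_Suc_eq le_zero_eq numeral_2_eq_2)

text \<open>The reason why choices are never revised: overlay \<open>A\<close> on any solution
  \<open>t\<close>. A link decided only by \<open>t\<close> is required, and since \<open>A\<close>
  is closed, neither of its ends is a node taken by \<open>A\<close>.\<close>

lemma solution_extending:
  assumes "partial A" "conflict_free A" "closed A" "solution t"
  shows "\<exists>t. solution t \<and> agrees A t"
proof (intro exI conjI)
  let ?t = "\<lambda>e. if A e \<noteq> 0 then A e else t e"
  have apart: "target e (A e) \<noteq> target f (t f)"
    if "e < m" "f < m" "A e \<noteq> 0" "A f = 0" "t f \<noteq> 0" for e f
  proof -
    have "req f" using assms(4) that by (simp add: solution_def partial_def)
    moreover have "t f = 1 \<or> t f = 2" using solution_values[OF assms(4)] that by blast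
    moreover have "\<not> hits A e f" using assms(3) that by (simp add: closed_def)
    ultimately show ?thesis using that unfolding hits_def by metis
  qed
  have "partial ?t" using assms by (auto simp: partial_def solution_def)
  moreover have "conflict_free ?t"
    unfolding conflict_free_def
  proof (intro allI impI conjI)
    fix e assume "e < m" "?t e \<noteq> 0"
    then show "ok e (?t e)" using assms by (auto simp: conflict_free_def solution_def)
    fix f assume "f < m" "e \<noteq> f" "?t f \<noteq> 0"
    then show "target e (?t e) \<noteq> target f (?t f)"
      using \<open>e < m\<close> \<open>?t e \<noteq> 0\<close> assms(2,4) apart[of e f] apart[of f e]
      by (auto simp: conflict_free_def solution_def split: if_splits)
  qed
  ultimately show "solution ?t" using assms(4) by (auto simp: solution_def)
  show "agrees A ?t" by (simp add: agrees_def)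
qed

end

text \<open>In the input array \<open>z\<close> the budgets start at cell 3 and the links at cell \<open>3 + 2 * z 1\<close>. The two ends
  of a link are selected by \<open>x = 1\<close> and \<open>x = 2\<close>, as 0 means that no end has been chosen.\<close>

definition endpoint :: "(nat \<Rightarrow> nat) \<Rightarrow> nat \<Rightarrow> nat \<Rightarrow> nat" where
  "endpoint z j x = z (2 + 2 * z 1 + 4 * j + x)"

text \<open>A link occupies four consecutive cells: its two ends, then numerator and denominator of
  its coefficient.\<close>

definition num :: "(nat \<Rightarrow> nat) \<Rightarrow> nat \<Rightarrow> nat" where
  "num z j = z (5 + 2 * z 1 + 4 * j)"

definition den :: "(nat \<Rightarrow> nat) \<Rightarrow> nat \<Rightarrow> nat" where
  "den z j = z (6 + 2 * z 1 + 4 * j)"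

definition budget_num :: "(nat \<Rightarrow> nat) \<Rightarrow> nat \<Rightarrow> nat" where
  "budget_num z v = z (3 + 2 * v)"

definition budget_den :: "(nat \<Rightarrow> nat) \<Rightarrow> nat \<Rightarrow> nat" where
  "budget_den z v = z (4 + 2 * v)"

definition cheaper :: "(nat \<Rightarrow> nat) \<Rightarrow> nat \<Rightarrow> nat \<Rightarrow> bool" where
  "cheaper z i j \<longleftrightarrow> num z i * den z j < num z j * den z i"

text \<open>The inequality \<open>p q < c (p + q)\<close> for the coefficients of the links that
  \<open>b\<close> records at the two ends, multiplied by all three denominators so that naturals
  suffice.\<close>

definition required :: "(nat \<Rightarrow> nat) \<Rightarrow> (nat \<Rightarrow> nat) \<Rightarrow> nat \<Rightarrow> bool" where
  "required z b j \<longleftrightarrow> 0 < budget_num z (endpoint z j 1) \<and> 0 < budget_num z (endpoint z j 2) \<and>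
     (let p = b (endpoint z j 1); q = b (endpoint z j 2) in
       num z p * num z q * den z j < num z j * (num z p * den z q + num z q * den z p))"

section \<open>Expressions and text of the solver program\<close>

definition endpoint_ex :: "aexp \<Rightarrow> aexp \<Rightarrow> aexp" where
  "endpoint_ex j x =
     Cell 0 (Plus (Plus (Plus (Num 2) (Times (Num 2) (Cell 0 (Num 1)))) (Times (Num 4) j)) x)"

definition num_ex :: "aexp \<Rightarrow> aexp" where
  "num_ex j = Cell 0 (Plus (Plus (Num 5) (Times (Num 2) (Cell 0 (Num 1)))) (Times (Num 4) j))"

definition den_ex :: "aexp \<Rightarrow> aexp" where
  "den_ex j = Cell 0 (Plus (Plus (Num 6) (Times (Num 2) (Cell 0 (Num 1)))) (Times (Num 4) j))"

definition budget_num_ex :: "aexp \<Rightarrow> aexp" where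
  "budget_num_ex v = Cell 0 (Plus (Num 3) (Times (Num 2) v))"

definition budget_den_ex :: "aexp \<Rightarrow> aexp" where
  "budget_den_ex v = Cell 0 (Plus (Num 4) (Times (Num 2) v))"

definition cheaper_ex :: "aexp \<Rightarrow> aexp \<Rightarrow> bexp" where
  "cheaper_ex i j = Less (Times (num_ex i) (den_ex j)) (Times (num_ex j) (den_ex i))"

definition required_ex :: "aexp \<Rightarrow> bexp" where
  "required_ex j =
     (let u = endpoint_ex j (Num 1); v = endpoint_ex j (Num 2); p = Cell 2 u; q = Cell 2 v in
      Conj (Less (Num 0) (budget_num_ex u)) (Conj (Less (Num 0) (budget_num_ex v))
        (Less (Times (Times (num_ex p) (num_ex q)) (den_ex j))
          (Times (num_ex j) (Plus (Times (num_ex p) (den_ex q)) (Times (num_ex q) (den_ex p)))))))"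

lemma aval_input [simp]:
  "aval (endpoint_ex j x) \<sigma> = endpoint (\<sigma> 0) (aval j \<sigma>) (aval x \<sigma>)"
  "aval (num_ex j) \<sigma> = num (\<sigma> 0) (aval j \<sigma>)"
  "aval (den_ex j) \<sigma> = den (\<sigma> 0) (aval j \<sigma>)"
  "aval (budget_num_ex x) \<sigma> = budget_num (\<sigma> 0) (aval x \<sigma>)"
  "aval (budget_den_ex x) \<sigma> = budget_den (\<sigma> 0) (aval x \<sigma>)"
  by (simp_all add: endpoint_ex_def num_ex_def den_ex_def budget_num_ex_def budget_den_ex_def
      endpoint_def num_def den_def budget_num_def budget_den_def)

lemma bval_input [simp]:
  "bval (cheaper_ex i j) \<sigma> \<longleftrightarrow> cheaper (\<sigma> 0) (aval i \<sigma>) (aval j \<sigma>)"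
  "bval (required_ex j) \<sigma> \<longleftrightarrow> required (\<sigma> 0) (\<sigma> 2) (aval j \<sigma>)"
  by (simp_all add: cheaper_ex_def cheaper_def required_ex_def required_def Let_def)

lemma copied_input [simp]:
  "copied (endpoint_ex j x)" "copied (budget_num_ex v)" "copied (budget_den_ex v)"
  by (simp_all add: endpoint_ex_def budget_num_ex_def budget_den_ex_def)

text \<open>Arrays: 2 maps a node to its chosen link, 4 is the current partial assignment of sides to links,
  5 a tentative one, 6 and 7 flag insolvability and conflicts, and 10 to 13 hold loop counters.\<close>

abbreviation "loop_k \<equiv> Cell 10 (Num 0)"
abbreviation "loop_e \<equiv> Cell 12 (Num 0)"
abbreviation "loop_f \<equiv> Cell 13 (Num 0)"
abbreviation "target_ex a j \<equiv> endpoint_ex j (Cell a j)"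

definition improve :: "aexp \<Rightarrow> prog" where
  "improve x = Choose (cheaper_ex (Cell 2 (endpoint_ex loop_e x)) loop_e)
     (Store 2 (endpoint_ex loop_e x) loop_e) Nop"

text \<open>The first pass gives each non-isolated node some incident link, since the initial value
  0 would name link 0, which may not be incident. The second pass then improves.\<close>

definition find_best :: prog where
  "find_best =
     Loop 12 2 (Store 2 (endpoint_ex loop_e (Num 1)) loop_e ;;
       Store 2 (endpoint_ex loop_e (Num 2)) loop_e) ;;
     Loop 12 2 (improve (Num 1) ;; improve (Num 2))"

definition force_prog :: prog where
  "force_prog =
     Choose (Conj (Neg (Equal loop_e loop_f)) (Conj (Neg (Equal (Cell 5 loop_e) (Num 0)))
         (Conj (required_ex loop_f) (Equal (Cell 5 loop_f) (Num 0)))))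
       (Choose (Equal (target_ex 5 loop_e) (endpoint_ex loop_f (Num 1)))
         (Store 5 loop_f (Num 2))
         (Choose (Equal (target_ex 5 loop_e) (endpoint_ex loop_f (Num 2)))
           (Store 5 loop_f (Num 1)) Nop))
       Nop"

definition sweep :: prog where
  "sweep = Loop 12 2 (Loop 13 2 force_prog)"

definition check_edge :: prog where
  "check_edge =
     Choose (Conj (Neg (Equal (Cell 5 loop_e) (Num 0)))
         (cheaper_ex loop_e (Cell 2 (target_ex 5 loop_e))))
       (Store 7 (Num 0) (Num 1)) Nop ;;
     Loop 13 2 (Choose (Conj (Neg (Equal loop_e loop_f))
         (Conj (Neg (Equal (Cell 5 loop_e) (Num 0))) (Conj (Neg (Equal (Cell 5 loop_f) (Num 0)))
           (Equal (target_ex 5 loop_e) (target_ex 5 loop_f)))))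
       (Store 7 (Num 0) (Num 1)) Nop)"

definition check_conflicts :: prog where
  "check_conflicts = Store 7 (Num 0) (Num 0) ;; Loop 12 2 check_edge"

text \<open>\<open>sweep\<close> is repeated once per link, which is enough because each sweep
  decides a further link until nothing is forced.\<close>

definition try_side :: "nat \<Rightarrow> prog" where
  "try_side x =
     Loop 12 2 (Store 5 loop_e (Cell 4 loop_e)) ;; Store 5 loop_k (Num x) ;;
     Loop 11 2 sweep ;; check_conflicts"

definition accept :: prog where
  "accept = Loop 12 2 (Store 4 loop_e (Cell 5 loop_e))"

text \<open>If both ends fail, the flag in array 6 is raised and never cleared; array 4 keeps its
  valid contents, so the invariant of the outer loop persists.\<close>

definition assign_link :: prog where
  "assign_link =
     Choose (Conj (required_ex loop_k) (Equal (Cell 4 loop_k) (Num 0)))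
       (try_side 1 ;; Choose (Equal (Cell 7 (Num 0)) (Num 0)) accept
         (try_side 2 ;; Choose (Equal (Cell 7 (Num 0)) (Num 0)) accept (Store 6 (Num 0) (Num 1))))
       Nop"

definition redirect :: prog where
  "redirect = Loop 12 2 (Choose (Equal (Cell 4 loop_e) (Num 0)) Nop
     (Store 2 (target_ex 4 loop_e) loop_e))"

text \<open>Link \<open>j\<close> fills output cells \<open>2 + 4 * j\<close> to
  \<open>5 + 4 * j\<close>, as cell 0 is reserved for the length and cell 1 for the decision. The
  pair 0, 1 encodes the rational 0.\<close>

definition emit_side :: "nat \<Rightarrow> prog" where
  "emit_side x = (let v = endpoint_ex loop_e (Num x); i = Plus (Num (2 * x)) (Times (Num 4) loop_e) in
     Choose (Equal (Cell 2 v) loop_e)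
       (Store 1 i (budget_num_ex v) ;; Store 1 (Plus (Num 1) i) (budget_den_ex v))
       (Store 1 i (Num 0) ;; Store 1 (Plus (Num 1) i) (Num 1)))"

definition emit :: prog where
  "emit = Store 1 (Num 1) (Num 1) ;; Loop 12 2 (emit_side 1 ;; emit_side 2)"

definition solver :: prog where
  "solver = find_best ;; Loop 10 2 assign_link ;;
     Choose (Equal (Cell 6 (Num 0)) (Num 0)) (redirect ;; emit) Nop"

lemmas prog_defs = improve_def find_best_def force_prog_def sweep_def check_edge_def
  check_conflicts_def try_side_def accept_def assign_link_def redirect_def emit_side_def emit_def

lemma writes_prog [simp]:
  "writes find_best = {2, 12}" "writes force_prog = {5}" "writes sweep = {5, 12, 13}"
  "writes check_edge = {7, 13}" "writes check_conflicts = {7, 12, 13}"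
  "writes (try_side x) = {5, 7, 11, 12, 13}" "writes accept = {4, 12}"
  "writes assign_link = {4, 5, 6, 7, 11, 12, 13}" "writes redirect = {2, 12}"
  "writes emit = {1, 12}"
  by (auto simp: prog_defs Let_def)

lemma admissible_solver: "admissible solver"
  by (auto simp: solver_def prog_defs Let_def)

lemma unwritten [simp]:
  "a \<notin> {2, 12} \<Longrightarrow> run find_best \<sigma> a = \<sigma> a"
  "a \<notin> {5} \<Longrightarrow> run force_prog \<sigma> a = \<sigma> a"
  "a \<notin> {5, 12, 13} \<Longrightarrow> run sweep \<sigma> a = \<sigma> a"
  "a \<notin> {7, 13} \<Longrightarrow> run check_edge \<sigma> a = \<sigma> a"
  "a \<notin> {7, 12, 13} \<Longrightarrow> run check_conflicts \<sigma> a = \<sigma> a"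
  "a \<notin> {5, 7, 11, 12, 13} \<Longrightarrow> run (try_side x) \<sigma> a = \<sigma> a"
  "a \<notin> {4, 12} \<Longrightarrow> run accept \<sigma> a = \<sigma> a"
  "a \<notin> {4, 5, 6, 7, 11, 12, 13} \<Longrightarrow> run assign_link \<sigma> a = \<sigma> a"
  "a \<notin> {2, 12} \<Longrightarrow> run redirect \<sigma> a = \<sigma> a"
  "a \<notin> {1, 12} \<Longrightarrow> run emit \<sigma> a = \<sigma> a"
  by (auto intro!: run_unwritten)

lemma copy_loop:
  assumes "a \<noteq> 12" "b \<noteq> 12" "a \<noteq> b" "a \<noteq> 0" "j < \<sigma> 0 2"
  shows "run (Loop 12 2 (Store a loop_e (Cell b loop_e))) \<sigma> a j = \<sigma> b j"
proof -
  let ?Inv = "\<lambda>k \<tau>. \<forall>j<k. \<tau> a j = \<sigma> b j"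
  have "?Inv (\<sigma> 0 2) (run (Loop 12 2 (Store a loop_e (Cell b loop_e))) \<sigma>)"
  proof (rule run_Loop_invariant[where Inv = ?Inv])
    show "admissible (Loop 12 2 (Store a loop_e (Cell b loop_e)))" using assms by simp
  next
    fix k \<tau>
    assume k: "k < \<sigma> 0 2" "\<tau> 12 0 = k"
      and same: "\<And>c. c \<notin> writes (Store a loop_e (Cell b loop_e)) \<Longrightarrow> c \<noteq> 12 \<Longrightarrow> \<tau> c = \<sigma> c"
      and inv: "?Inv k \<tau>"
    have "\<tau> b = \<sigma> b" using same assms by simp
    then show "?Inv (Suc k) ((run (Store a loop_e (Cell b loop_e)) \<tau>)(12 := (\<tau> 12)(0 := Suc k)))"
      using inv k assms by (auto simp: less_Suc_eq)
  qed simp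
  then show ?thesis using assms by blast
qed

section \<open>Correctness of the program for a fixed input array and table of best links\<close>

locale solver_run =
  fixes z b :: "nat \<Rightarrow> nat"

text \<open>An end is permitted iff the link is no cheaper than the link \<open>b\<close> records
  for that node.\<close>

sublocale solver_run \<subseteq> two_choice "z 2" "required z b" "endpoint z" "\<lambda>e x. \<not> cheaper z e (b (endpoint z e x))" .

context solver_run
begin

lemma run_force_prog:
  assumes "\<sigma> 0 = z" "\<sigma> 2 = b"
  shows "run force_prog \<sigma> 5 = force (\<sigma> 12 0) (\<sigma> 13 0) (\<sigma> 5)"
  using assms by (auto simp: force_prog_def force_def hits_def)

text \<open>Hits refer to the assignment before the pass. A link \<open>e\<close> that hits
  something is already decided, so its end stays fixed; an \<open>f\<close> decided on the way keeps
  its value, and otherwise the hit still stands when \<open>f\<close> is reached.\<close>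

lemma run_sweep_inner:
  assumes \<sigma>: "\<sigma> 0 = z" "\<sigma> 2 = b" "\<sigma> 12 0 = e" "e < z 2"
  defines "\<tau> \<equiv> run (Loop 13 2 force_prog) \<sigma>"
  shows "derives (\<sigma> 5) (\<tau> 5) \<and> (\<forall>f<z 2. hits (\<sigma> 5) e f \<longrightarrow> \<tau> 5 f \<noteq> 0)"
proof -
  let ?Inv = "\<lambda>k \<tau>. derives (\<sigma> 5) (\<tau> 5) \<and> (\<forall>f<k. hits (\<sigma> 5) e f \<longrightarrow> \<tau> 5 f \<noteq> 0)"
  have "?Inv (\<sigma> 0 2) \<tau>"
    unfolding \<tau>_def
  proof (rule run_Loop_invariant[where Inv = ?Inv])
    show "admissible (Loop 13 2 force_prog)" by (simp add: force_prog_def)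
    show "?Inv 0 (\<sigma>(13 := (\<sigma> 13)(0 := 0)))" by (simp add: derives_refl)
  next
    fix k \<tau>
    assume k: "k < \<sigma> 0 2" "\<tau> 13 0 = k"
      and same: "\<And>c. c \<notin> writes force_prog \<Longrightarrow> c \<noteq> 13 \<Longrightarrow> \<tau> c = \<sigma> c"
      and inv: "?Inv k \<tau>"
    have \<tau>: "\<tau> 0 = z" "\<tau> 2 = b" "\<tau> 12 0 = e"
      using same \<sigma> by auto
    then have T: "run force_prog \<tau> 5 = force e k (\<tau> 5)"
      using run_force_prog[of \<tau>] k by simp
    have k': "k < z 2" using k \<sigma> by simp
    then have d: "derives (\<tau> 5) (force e k (\<tau> 5))" by (intro derives_force \<sigma>)
    have "force e k (\<tau> 5) f \<noteq> 0" if "f < Suc k" "hits (\<sigma> 5) e f" for f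
    proof (cases "\<tau> 5 f = 0")
      case False
      then show ?thesis using derives_assigned[OF d, of f] that(1) k' by simp
    next
      case True
      with inv that have "f = k" by (auto simp: less_Suc_eq)
      moreover from True that(2) inv \<sigma>(4) have "hits (\<tau> 5) e f"
        using derives_assigned[of "\<sigma> 5" "\<tau> 5" e] by (auto simp: hits_def)
      ultimately show ?thesis by (simp add: force_hit)
    qed
    then show "?Inv (Suc k) ((run force_prog \<tau>)(13 := (\<tau> 13)(0 := Suc k)))"
      using inv derives_trans[OF _ d] T by auto
  qed
  then show ?thesis using \<sigma> by simp
qed

lemma run_sweep:
  assumes \<sigma>: "\<sigma> 0 = z" "\<sigma> 2 = b"
  shows "derives (\<sigma> 5) (run sweep \<sigma> 5)"
    and "e < z 2 \<Longrightarrow> f < z 2 \<Longrightarrow> hits (\<sigma> 5) e f \<Longrightarrow> run sweep \<sigma> 5 f \<noteq> 0"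
proof -
  let ?c = "Loop 13 2 force_prog"
  let ?Inv = "\<lambda>k \<tau>. derives (\<sigma> 5) (\<tau> 5) \<and> (\<forall>e<k. \<forall>f<z 2. hits (\<sigma> 5) e f \<longrightarrow> \<tau> 5 f \<noteq> 0)"
  have "?Inv (\<sigma> 0 2) (run sweep \<sigma>)"
    unfolding sweep_def
  proof (rule run_Loop_invariant[where Inv = ?Inv])
    show "admissible (Loop 12 2 ?c)" by (simp add: force_prog_def)
    show "?Inv 0 (\<sigma>(12 := (\<sigma> 12)(0 := 0)))" by (simp add: derives_refl)
  next
    fix k \<tau>
    assume k: "k < \<sigma> 0 2" "\<tau> 12 0 = k"
      and same: "\<And>a. a \<notin> writes ?c \<Longrightarrow> a \<noteq> 12 \<Longrightarrow> \<tau> a = \<sigma> a"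
      and inv: "?Inv k \<tau>"
    have \<tau>: "\<tau> 0 = z" "\<tau> 2 = b" using same \<sigma> by auto
    have k': "k < z 2" using k \<sigma> by simp
    from run_sweep_inner[OF \<tau> k(2) k']
    have d: "derives (\<tau> 5) (run ?c \<tau> 5)" and h: "\<And>f. f < z 2 \<Longrightarrow> hits (\<tau> 5) k f \<Longrightarrow> run ?c \<tau> 5 f \<noteq> 0"
      by auto
    have "run ?c \<tau> 5 f \<noteq> 0" if "e < Suc k" "f < z 2" "hits (\<sigma> 5) e f" for e f
    proof (cases "\<tau> 5 f = 0")
      case False
      then show ?thesis using derives_assigned[OF d that(2)] by simp
    next
      case True
      with inv that have "e = k" by (metis less_SucE)
      moreover from True that(3) inv k' this have "hits (\<tau> 5) e f"
        using derives_assigned[of "\<sigma> 5" "\<tau> 5" e] by (auto simp: hits_def)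
      ultimately show ?thesis using h that by simp
    qed
    then show "?Inv (Suc k) ((run ?c \<tau>)(12 := (\<tau> 12)(0 := Suc k)))"
      using inv derives_trans[OF _ d] by (auto simp del: run.simps)
  qed
  then show "derives (\<sigma> 5) (run sweep \<sigma> 5)"
    and "e < z 2 \<Longrightarrow> f < z 2 \<Longrightarrow> hits (\<sigma> 5) e f \<Longrightarrow> run sweep \<sigma> 5 f \<noteq> 0"
    using \<sigma> by auto
qed

text \<open>Each round finds the assignment closed or decides one more link; after as many rounds as
  there are links, the second alternative leaves nothing undecided.\<close>

lemma run_saturate:
  assumes \<sigma>: "\<sigma> 0 = z" "\<sigma> 2 = b"
  defines "\<tau> \<equiv> run (Loop 11 2 sweep) \<sigma>"
  shows "derives (\<sigma> 5) (\<tau> 5)" and "closed (\<tau> 5)"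
proof -
  let ?Inv = "\<lambda>r \<tau>. derives (\<sigma> 5) (\<tau> 5) \<and> (closed (\<tau> 5) \<or> r \<le> card (assigned (\<tau> 5)))"
  have "?Inv (\<sigma> 0 2) \<tau>"
    unfolding \<tau>_def
  proof (rule run_Loop_invariant[where Inv = ?Inv])
    show "admissible (Loop 11 2 sweep)" by (simp add: sweep_def force_prog_def)
    show "?Inv 0 (\<sigma>(11 := (\<sigma> 11)(0 := 0)))" by (simp add: derives_refl)
  next
    fix r \<tau>
    assume same: "\<And>a. a \<notin> writes sweep \<Longrightarrow> a \<noteq> 11 \<Longrightarrow> \<tau> a = \<sigma> a"
      and inv: "?Inv r \<tau>"
    have \<tau>: "\<tau> 0 = z" "\<tau> 2 = b" using same \<sigma> by auto
    have "derives (\<sigma> 5) (run sweep \<tau> 5)"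
      using inv derives_trans run_sweep(1)[OF \<tau>] by blast
    moreover have "closed (run sweep \<tau> 5) \<or> Suc r \<le> card (assigned (run sweep \<tau> 5))"
      using inv run_sweep[OF \<tau>] by (intro assigned_grows) auto
    ultimately show "?Inv (Suc r) ((run sweep \<tau>)(11 := (\<tau> 11)(0 := Suc r)))" by simp
  qed
  then show "derives (\<sigma> 5) (\<tau> 5)" and "closed (\<tau> 5)"
    using closed_if_all_assigned[of "\<tau> 5"] unfolding \<sigma>(1) by blast+
qed

definition clash :: "(nat \<Rightarrow> nat) \<Rightarrow> nat \<Rightarrow> nat \<Rightarrow> bool" where
  "clash T e f \<longleftrightarrow> e \<noteq> f \<and> T e \<noteq> 0 \<and> T f \<noteq> 0 \<and> endpoint z e (T e) = endpoint z f (T f)"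

definition bad :: "(nat \<Rightarrow> nat) \<Rightarrow> nat \<Rightarrow> bool" where
  "bad T e \<longleftrightarrow> T e \<noteq> 0 \<and> cheaper z e (b (endpoint z e (T e))) \<or> (\<exists>f<z 2. clash T e f)"

lemma conflict_free_iff: "conflict_free T \<longleftrightarrow> (\<forall>e<z 2. \<not> bad T e)"
  unfolding conflict_free_def bad_def clash_def de_Morgan_disj de_Morgan_conj not_ex not_not
  by (intro all_cong1 imp_cong refl) metis

lemma run_check_edge:
  assumes \<sigma>: "\<sigma> 0 = z" "\<sigma> 2 = b"
  shows "run check_edge \<sigma> 7 0 = 0 \<longleftrightarrow> \<sigma> 7 0 = 0 \<and> \<not> bad (\<sigma> 5) (\<sigma> 12 0)"
proof -
  let ?e = "\<sigma> 12 0"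
  define first where "first = Choose (Conj (Neg (Equal (Cell 5 loop_e) (Num 0)))
         (cheaper_ex loop_e (Cell 2 (target_ex 5 loop_e)))) (Store 7 (Num 0) (Num 1)) Nop"
  define c where "c = Choose (Conj (Neg (Equal loop_e loop_f))
         (Conj (Neg (Equal (Cell 5 loop_e) (Num 0))) (Conj (Neg (Equal (Cell 5 loop_f) (Num 0)))
           (Equal (target_ex 5 loop_e) (target_ex 5 loop_f))))) (Store 7 (Num 0) (Num 1)) Nop"
  define \<rho> where "\<rho> = run first \<sigma>"
  have \<rho>: "\<rho> 7 0 = 0 \<longleftrightarrow> \<sigma> 7 0 = 0 \<and> \<not> (\<sigma> 5 ?e \<noteq> 0 \<and> cheaper z ?e (b (endpoint z ?e (\<sigma> 5 ?e))))"
      "a \<noteq> 7 \<Longrightarrow> \<rho> a = \<sigma> a" for a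
    using \<sigma> by (auto simp: \<rho>_def first_def)
  let ?Inv = "\<lambda>k \<tau>. \<tau> 7 0 = 0 \<longleftrightarrow> \<rho> 7 0 = 0 \<and> \<not> (\<exists>f<k. clash (\<sigma> 5) ?e f)"
  have "?Inv (\<rho> 0 2) (run (Loop 13 2 c) \<rho>)"
  proof (rule run_Loop_invariant[where Inv = ?Inv])
    show "admissible (Loop 13 2 c)" by (simp add: c_def)
    show "?Inv 0 (\<rho>(13 := (\<rho> 13)(0 := 0)))" by simp
  next
    fix k \<tau>
    assume k: "k < \<rho> 0 2" "\<tau> 13 0 = k"
      and same: "\<And>a. a \<notin> writes c \<Longrightarrow> a \<noteq> 13 \<Longrightarrow> \<tau> a = \<rho> a"
      and inv: "?Inv k \<tau>"
    have \<tau>: "\<tau> 0 = z" "\<tau> 5 = \<sigma> 5" "\<tau> 12 = \<sigma> 12" using same \<rho>(2) \<sigma> by (auto simp: c_def)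
    have "run c \<tau> 7 0 = 0 \<longleftrightarrow> \<tau> 7 0 = 0 \<and> \<not> clash (\<sigma> 5) ?e k"
      using \<tau> k by (auto simp: c_def clash_def)
    then show "?Inv (Suc k) ((run c \<tau>)(13 := (\<tau> 13)(0 := Suc k)))"
      using inv by (auto simp: less_Suc_eq)
  qed
  moreover have "run check_edge \<sigma> = run (Loop 13 2 c) \<rho>"
    by (simp add: check_edge_def c_def \<rho>_def first_def)
  ultimately show ?thesis
    using \<rho> \<sigma> by (auto simp: bad_def)
qed

lemma run_check_conflicts:
  assumes \<sigma>: "\<sigma> 0 = z" "\<sigma> 2 = b"
  shows "run check_conflicts \<sigma> 7 0 = 0 \<longleftrightarrow> conflict_free (\<sigma> 5)"
proof -
  define \<rho> where "\<rho> = \<sigma>(7 := (\<sigma> 7)(0 := 0))"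
  let ?Inv = "\<lambda>k \<tau>. \<tau> 7 0 = 0 \<longleftrightarrow> (\<forall>e<k. \<not> bad (\<sigma> 5) e)"
  have "?Inv (\<rho> 0 2) (run (Loop 12 2 check_edge) \<rho>)"
  proof (rule run_Loop_invariant[where Inv = ?Inv])
    show "admissible (Loop 12 2 check_edge)" by (simp add: check_edge_def)
    show "?Inv 0 (\<rho>(12 := (\<rho> 12)(0 := 0)))" by (simp add: \<rho>_def)
  next
    fix k \<tau>
    assume k: "k < \<rho> 0 2" "\<tau> 12 0 = k"
      and same: "\<And>a. a \<notin> writes check_edge \<Longrightarrow> a \<noteq> 12 \<Longrightarrow> \<tau> a = \<rho> a"
      and inv: "?Inv k \<tau>"
    have \<tau>: "\<tau> 0 = z" "\<tau> 2 = b" "\<tau> 5 = \<sigma> 5" using same \<sigma> by (auto simp: \<rho>_def)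
    show "?Inv (Suc k) ((run check_edge \<tau>)(12 := (\<tau> 12)(0 := Suc k)))"
      using inv run_check_edge[OF \<tau>(1,2)] \<tau>(3) k by (auto simp: less_Suc_eq)
  qed
  then show ?thesis
    using \<sigma> by (simp add: check_conflicts_def \<rho>_def conflict_free_iff)
qed

text \<open>No solution with \<open>t k = x\<close> that extends the current assignment is lost, so
  a conflict after saturation refutes end \<open>x\<close> for link \<open>k\<close> relative to the
  earlier decisions.\<close>

lemma run_try_side:
  assumes \<sigma>: "\<sigma> 0 = z" "\<sigma> 2 = b" "\<sigma> 10 0 = k" "k < z 2"
    and A: "partial (\<sigma> 4)" "required z b k" "\<sigma> 4 k = 0" and x: "x = 1 \<or> x = 2"
  defines "\<tau> \<equiv> run (try_side x) \<sigma>"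
  shows "agrees (\<sigma> 4) (\<tau> 5)" and "\<tau> 5 k \<noteq> 0" and "partial (\<tau> 5)" and "closed (\<tau> 5)"
    and "solution t \<Longrightarrow> agrees (\<sigma> 4) t \<Longrightarrow> t k = x \<Longrightarrow> agrees (\<tau> 5) t"
    and "\<tau> 7 0 = 0 \<longleftrightarrow> conflict_free (\<tau> 5)"
proof -
  define \<rho> where "\<rho> = run (Loop 12 2 (Store 5 loop_e (Cell 4 loop_e)) ;; Store 5 loop_k (Num x)) \<sigma>"
  have same: "\<rho> a = \<sigma> a" if "a \<notin> {5, 12}" for a
    unfolding \<rho>_def by (rule run_unwritten) (use that in simp)
  have "\<rho> 5 j = ((run (Loop 12 2 (Store 5 loop_e (Cell 4 loop_e))) \<sigma> 5)(k := x)) j" for j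
    unfolding \<rho>_def run.simps(3)
    using run_unwritten[of 10 "Loop 12 2 (Store 5 loop_e (Cell 4 loop_e))" \<sigma>] \<sigma>
    by (simp del: run.simps(5) add: run.simps(2))
  then have T: "\<rho> 5 j = (if j = k then x else \<sigma> 4 j)" if "j < z 2" for j
    using copy_loop[of 5 4 j \<sigma>] that \<sigma> by (simp del: run.simps)
  define \<rho>' where "\<rho>' = run (Loop 11 2 sweep) \<rho>"
  have \<rho>: "\<rho> 0 = z" "\<rho> 2 = b" using same \<sigma> by auto
  have \<rho>': "\<rho>' 0 = z" "\<rho>' 2 = b"
    using run_unwritten[of 0 "Loop 11 2 sweep" \<rho>] run_unwritten[of 2 "Loop 11 2 sweep" \<rho>] \<rho>
    unfolding \<rho>'_def by (simp_all del: run.simps)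
  have \<tau>: "\<tau> = run check_conflicts \<rho>'"
    unfolding \<tau>_def \<rho>'_def \<rho>_def try_side_def by simp
  then have \<tau>5: "\<tau> 5 = \<rho>' 5" by simp
  note sat = run_saturate[OF \<rho>, folded \<rho>'_def, folded \<tau>5]
  show "closed (\<tau> 5)" by (rule sat(2))
  have k: "\<tau> 5 k = x"
    using derives_assigned[OF sat(1) \<sigma>(4)] T[OF \<sigma>(4)] x by auto
  then show "\<tau> 5 k \<noteq> 0" using x by auto
  show "agrees (\<sigma> 4) (\<tau> 5)"
    unfolding agrees_def
  proof (intro allI impI)
    fix e assume e: "e < z 2" "\<sigma> 4 e \<noteq> 0"
    then have "e \<noteq> k" using A(3) by blast
    then show "\<tau> 5 e = \<sigma> 4 e" using derives_assigned[OF sat(1) e(1)] T[OF e(1)] e(2) by simp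
  qed
  have "partial (\<rho> 5)" using A x T by (auto simp: partial_def)
  then show "partial (\<tau> 5)" using sat(1) by (simp add: derives_def)
  show "agrees (\<tau> 5) t" if "solution t" "agrees (\<sigma> 4) t" "t k = x"
  proof -
    have "agrees (\<rho> 5) t" using that(2,3) T by (auto simp: agrees_def)
    with sat(1) that(1) show ?thesis by (simp add: derives_def)
  qed
  show "\<tau> 7 0 = 0 \<longleftrightarrow> conflict_free (\<tau> 5)"
    using run_check_conflicts[OF \<rho>'] \<tau>5 by (simp add: \<tau>)
qed

definition consistent :: "(nat \<Rightarrow> nat) \<Rightarrow> bool" where
  "consistent A \<longleftrightarrow> partial A \<and> conflict_free A \<and> closed A"

lemma consistent_cong: "(\<And>j. j < z 2 \<Longrightarrow> A j = A' j) \<Longrightarrow> consistent A \<longleftrightarrow> consistent A'"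
  by (simp add: consistent_def partial_def conflict_free_def closed_def hits_def)

lemma conflict_free_agrees: "solution t \<Longrightarrow> agrees T t \<Longrightarrow> conflict_free T"
  by (auto simp: solution_def conflict_free_def agrees_def) metis+

lemma run_accept: "\<sigma> 0 = z \<Longrightarrow> j < z 2 \<Longrightarrow> run accept \<sigma> 4 j = \<sigma> 5 j"
  unfolding accept_def by (rule copy_loop) auto

text \<open>An accepted trial is again conflict-free and closed, as
  \<open>solution_extending\<close> demands of it. This is why failure of both ends rules out every
  solution, not merely those extending the current assignment.\<close>

lemma run_assign_link:
  assumes \<sigma>: "\<sigma> 0 = z" "\<sigma> 2 = b" "\<sigma> 10 0 = k" "k < z 2" and A: "consistent (\<sigma> 4)"
  defines "\<tau> \<equiv> run assign_link \<sigma>"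
  shows "consistent (\<tau> 4) \<and> agrees (\<sigma> 4) (\<tau> 4) \<and>
    (\<tau> 6 0 = \<sigma> 6 0 \<and> (required z b k \<longrightarrow> \<tau> 4 k \<noteq> 0) \<or> \<tau> 6 0 \<noteq> 0 \<and> \<not> (\<exists>t. solution t))"
proof (cases "required z b k \<and> \<sigma> 4 k = 0")
  case False
  then have "\<tau> = \<sigma>" using \<sigma> by (auto simp: \<tau>_def assign_link_def)
  with False A show ?thesis by (auto simp: agrees_def)
next
  case True
  have adopt: "consistent (run accept \<rho> 4) \<and> agrees (\<sigma> 4) (run accept \<rho> 4) \<and> run accept \<rho> 4 k \<noteq> 0"
    if "\<rho> 0 = z" "agrees (\<sigma> 4) (\<rho> 5)" "\<rho> 5 k \<noteq> 0" "consistent (\<rho> 5)" for \<rho>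
    using that run_accept[of \<rho>] \<sigma>(4) consistent_cong[of "run accept \<rho> 4" "\<rho> 5"]
    by (auto simp: agrees_def)
  define \<rho>1 where "\<rho>1 = run (try_side 1) \<sigma>"
  define \<rho>2 where "\<rho>2 = run (try_side 2) \<rho>1"
  have pA: "partial (\<sigma> 4)" using A by (simp add: consistent_def)
  have \<rho>1: "\<rho>1 0 = z" "\<rho>1 2 = b" "\<rho>1 10 0 = k" "\<rho>1 4 = \<sigma> 4" "\<rho>1 6 = \<sigma> 6"
    and \<rho>2: "\<rho>2 0 = z" "\<rho>2 4 = \<sigma> 4" "\<rho>2 6 = \<sigma> 6"
    using \<sigma> by (simp_all add: \<rho>1_def \<rho>2_def)
  note t1 = run_try_side[OF \<sigma> pA, of 1, folded \<rho>1_def]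
  \<comment> \<open>The second trial starts from the memory left by the first, which has not touched
    arrays 0, 2, 4 and 10.\<close>
  note t2 = run_try_side[OF \<rho>1(1-3) \<sigma>(4), of 2, folded \<rho>2_def, unfolded \<rho>1(4), OF pA]
  have \<tau>: "\<tau> = (if \<rho>1 7 0 = 0 then run accept \<rho>1 else if \<rho>2 7 0 = 0 then run accept \<rho>2
      else \<rho>2(6 := (\<rho>2 6)(0 := 1)))"
    using True \<sigma> by (simp add: \<tau>_def assign_link_def \<rho>1_def \<rho>2_def)
  consider "\<rho>1 7 0 = 0" | "\<rho>1 7 0 \<noteq> 0" "\<rho>2 7 0 = 0" | "\<rho>1 7 0 \<noteq> 0" "\<rho>2 7 0 \<noteq> 0" by blast
  then show ?thesis
  proof cases
    case 1
    then show ?thesis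
      using adopt[of \<rho>1] t1 True \<rho>1 by (simp add: \<tau> consistent_def)
  next
    case 2
    then show ?thesis
      using adopt[of \<rho>2] t2 True \<rho>2 by (simp add: \<tau> consistent_def)
  next
    case 3
    have "\<not> solution t" for t
    proof
      assume "solution t"
      \<comment> \<open>The given solution is replaced by one that extends the current assignment;
        it survives in the trial of the end it gives to \<open>k\<close>, which is then free of
        conflicts.\<close>
      then obtain t where t: "solution t" "agrees (\<sigma> 4) t"
        using solution_extending A by (auto simp: consistent_def)
      then have "t k = 1 \<or> t k = 2"
        using True \<sigma>(4) solution_values[of t k] by (auto simp: solution_def)
      then have "agrees (\<rho>1 5) t \<or> agrees (\<rho>2 5) t"
        using t1(5) t2(5) t True by auto
      then show False
        using conflict_free_agrees[OF t(1)] t1(6) t2(6) 3 True by auto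
    qed
    then show ?thesis
      using 3 A \<rho>2 by (simp add: \<tau> agrees_def)
  qed
qed

lemma run_assign_all:
  assumes \<sigma>: "\<sigma> 0 = z" "\<sigma> 2 = b" "\<And>j. \<sigma> 4 j = 0" "\<sigma> 6 0 = 0"
  defines "\<tau> \<equiv> run (Loop 10 2 assign_link) \<sigma>"
  shows "\<tau> 6 0 = 0 \<Longrightarrow> solution (\<tau> 4)" and "\<tau> 6 0 \<noteq> 0 \<Longrightarrow> \<not> solution t"
proof -
  let ?Inv = "\<lambda>k \<tau>. consistent (\<tau> 4) \<and> (\<tau> 6 0 = 0 \<longrightarrow> (\<forall>j<k. required z b j \<longrightarrow> \<tau> 4 j \<noteq> 0)) \<and>
      (\<tau> 6 0 \<noteq> 0 \<longrightarrow> \<not> (\<exists>t. solution t))"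
  have "?Inv (\<sigma> 0 2) \<tau>"
    unfolding \<tau>_def
  proof (rule run_Loop_invariant[where Inv = ?Inv])
    show "admissible (Loop 10 2 assign_link)"
      using admissible_solver by (simp add: solver_def)
    show "?Inv 0 (\<sigma>(10 := (\<sigma> 10)(0 := 0)))"
      using \<sigma> by (simp add: consistent_def partial_def conflict_free_def closed_def hits_def)
  next
    fix k \<tau>
    assume k: "k < \<sigma> 0 2" "\<tau> 10 0 = k"
      and same: "\<And>a. a \<notin> writes assign_link \<Longrightarrow> a \<noteq> 10 \<Longrightarrow> \<tau> a = \<sigma> a"
      and inv: "?Inv k \<tau>"
    have \<tau>: "\<tau> 0 = z" "\<tau> 2 = b" using same \<sigma> by auto
    show "?Inv (Suc k) ((run assign_link \<tau>)(10 := (\<tau> 10)(0 := Suc k)))"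
      using inv run_assign_link[OF \<tau> k(2)] k(1) \<sigma> by (auto simp: less_Suc_eq agrees_def)
  qed
  then show "\<tau> 6 0 = 0 \<Longrightarrow> solution (\<tau> 4)" and "\<tau> 6 0 \<noteq> 0 \<Longrightarrow> \<not> solution t"
    using \<sigma> by (auto simp: solution_def consistent_def)
qed

end

definition is_end :: "(nat \<Rightarrow> nat) \<Rightarrow> nat \<Rightarrow> nat \<Rightarrow> bool" where
  "is_end z v j \<longleftrightarrow> v = endpoint z j 1 \<or> v = endpoint z j 2"

definition coeff :: "(nat \<Rightarrow> nat) \<Rightarrow> nat \<Rightarrow> real" where
  "coeff z j = real (num z j) / real (den z j)"

definition best_links :: "(nat \<Rightarrow> nat) \<Rightarrow> (nat \<Rightarrow> nat) \<Rightarrow> bool" where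
  "best_links z b \<longleftrightarrow> (\<forall>j<z 2. \<forall>v. is_end z v j \<longrightarrow> b v < z 2 \<and> is_end z v (b v) \<and> coeff z j \<le> coeff z (b v))"

lemma cheaper_iff: "0 < den z i \<Longrightarrow> 0 < den z j \<Longrightarrow> cheaper z i j \<longleftrightarrow> coeff z i < coeff z j"
  unfolding cheaper_def coeff_def
  by (simp add: frac_less_eq divide_less_eq less_divide_eq flip: of_nat_mult)

lemma run_improve:
  assumes "\<sigma> 0 = z" "\<sigma> 12 0 = j"
  shows "run (improve (Num x)) \<sigma> =
    (let v = endpoint z j x in if cheaper z (\<sigma> 2 v) j then \<sigma>(2 := (\<sigma> 2)(v := j)) else \<sigma>)"
  using assms by (simp add: improve_def Let_def)

lemma run_find_best:
  assumes \<sigma>: "\<sigma> 0 = z" and den: "\<And>j. j < z 2 \<Longrightarrow> 0 < den z j"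
  shows "best_links z (run find_best \<sigma> 2)"
proof -
  define first where "first = Store 2 (endpoint_ex loop_e (Num 1)) loop_e ;;
    Store 2 (endpoint_ex loop_e (Num 2)) loop_e"
  define \<rho> where "\<rho> = run (Loop 12 2 first) \<sigma>"
  let ?Inv = "\<lambda>k \<tau>. \<forall>v. (\<exists>j<k. is_end z v j) \<longrightarrow> \<tau> 2 v < z 2 \<and> is_end z v (\<tau> 2 v)"
  have "?Inv (\<sigma> 0 2) \<rho>"
    unfolding \<rho>_def
  proof (rule run_Loop_invariant[where Inv = ?Inv])
    show "admissible (Loop 12 2 first)" by (simp add: first_def)
  next
    fix k \<tau>
    assume k: "k < \<sigma> 0 2" "\<tau> 12 0 = k"
      and same: "\<And>a. a \<notin> writes first \<Longrightarrow> a \<noteq> 12 \<Longrightarrow> \<tau> a = \<sigma> a"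
      and inv: "?Inv k \<tau>"
    have \<tau>: "\<tau> 0 = z" using same \<sigma> by (simp add: first_def)
    have new: "run first \<tau> 2 v = (if is_end z v k then k else \<tau> 2 v)" for v
      using \<tau> k by (auto simp: first_def is_end_def)
    have "run first \<tau> 2 v < z 2 \<and> is_end z v (run first \<tau> 2 v)" if "j < Suc k" "is_end z v j" for v j
      using new[of v] k \<sigma> inv that by (cases "j = k") (auto simp: less_Suc_eq)
    then show "?Inv (Suc k) ((run first \<tau>)(12 := (\<tau> 12)(0 := Suc k)))" by auto
  qed simp
  then have start: "\<forall>v. (\<exists>j<z 2. is_end z v j) \<longrightarrow> \<rho> 2 v < z 2 \<and> is_end z v (\<rho> 2 v)"
    using \<sigma> by simp
  have \<rho>0: "\<rho> 0 = z"
    unfolding \<rho>_def using run_unwritten[of 0 "Loop 12 2 first" \<sigma>] \<sigma> by (simp add: first_def)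
  define second where "second = improve (Num 1) ;; improve (Num 2)"
  let ?Inv2 = "\<lambda>k \<tau>. \<forall>v. (\<exists>j<z 2. is_end z v j) \<longrightarrow> \<tau> 2 v < z 2 \<and> is_end z v (\<tau> 2 v) \<and>
     (\<forall>j<k. is_end z v j \<longrightarrow> coeff z j \<le> coeff z (\<tau> 2 v))"
  have "?Inv2 (\<rho> 0 2) (run (Loop 12 2 second) \<rho>)"
  proof (rule run_Loop_invariant[where Inv = ?Inv2])
    show "admissible (Loop 12 2 second)" by (simp add: second_def improve_def)
    show "?Inv2 0 (\<rho>(12 := (\<rho> 12)(0 := 0)))" using start by simp
  next
    fix k \<tau>
    assume k: "k < \<rho> 0 2" "\<tau> 12 0 = k"
      and same: "\<And>a. a \<notin> writes second \<Longrightarrow> a \<noteq> 12 \<Longrightarrow> \<tau> a = \<rho> a"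
      and inv: "?Inv2 k \<tau>"
    have \<tau>: "\<tau> 0 = z" using same \<rho>0 by (simp add: second_def improve_def)
    have k': "k < z 2" using k \<rho>0 by simp
    \<comment> \<open>For a link whose two ends coincide, the second test may compare
      \<open>k\<close> with itself; such links are not excluded at this level.\<close>
    have refl: "\<not> cheaper z k k" by (simp add: cheaper_def)
    have new: "run second \<tau> 2 v = (if is_end z v k \<and> cheaper z (\<tau> 2 v) k then k else \<tau> 2 v)" for v
      using \<tau> k refl by (auto simp: second_def run_improve Let_def is_end_def)
    have "run second \<tau> 2 v < z 2 \<and> is_end z v (run second \<tau> 2 v) \<and>
        (\<forall>j<Suc k. is_end z v j \<longrightarrow> coeff z j \<le> coeff z (run second \<tau> 2 v))"
      if "\<exists>j<z 2. is_end z v j" for v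
    proof -
      from inv that have *: "\<tau> 2 v < z 2" "is_end z v (\<tau> 2 v)"
          "\<And>j. j < k \<Longrightarrow> is_end z v j \<Longrightarrow> coeff z j \<le> coeff z (\<tau> 2 v)"
        by auto
      have c: "cheaper z (\<tau> 2 v) k \<longleftrightarrow> coeff z (\<tau> 2 v) < coeff z k"
        using cheaper_iff den *(1) k' by simp
      show ?thesis
      proof (cases "is_end z v k \<and> cheaper z (\<tau> 2 v) k")
        case True
        then show ?thesis
          using new[of v] *(3) c k' by (auto simp: less_Suc_eq intro: order_trans less_imp_le)
      next
        case False
        then show ?thesis using new[of v] * c by (auto simp: less_Suc_eq)
      qed
    qed
    then show "?Inv2 (Suc k) ((run second \<tau>)(12 := (\<tau> 12)(0 := Suc k)))" by auto
  qed
  moreover have "run find_best \<sigma> = run (Loop 12 2 second) \<rho>"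
    by (simp add: find_best_def second_def \<rho>_def first_def)
  ultimately show ?thesis
    unfolding best_links_def using \<rho>0 by auto
qed

text \<open>By the second clause a node leaves its best link only for a link that chose it; from
  this \<open>g v\<close> will again be incident and of maximal coefficient.\<close>

definition chosen_link :: "(nat \<Rightarrow> nat) \<Rightarrow> (nat \<Rightarrow> nat) \<Rightarrow> (nat \<Rightarrow> nat) \<Rightarrow> (nat \<Rightarrow> nat) \<Rightarrow> bool" where
  "chosen_link z b A g \<longleftrightarrow> (\<forall>e<z 2. A e \<noteq> 0 \<longrightarrow> g (endpoint z e (A e)) = e) \<and>
     (\<forall>v. g v = b v \<or> (g v < z 2 \<and> A (g v) \<noteq> 0 \<and> v = endpoint z (g v) (A (g v))))"

definition emitted :: "(nat \<Rightarrow> nat) \<Rightarrow> (nat \<Rightarrow> nat) \<Rightarrow> nat \<Rightarrow> (nat \<Rightarrow> nat) \<Rightarrow> bool" where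
  "emitted z g k out \<longleftrightarrow> out 1 = 1 \<and> (\<forall>j<k. \<forall>x\<in>{1, 2}. let v = endpoint z j x in
     out (2 * x + 4 * j) = (if g v = j then budget_num z v else 0) \<and>
     out (2 * x + 4 * j + 1) = (if g v = j then budget_den z v else 1))"

context solver_run
begin

lemma run_redirect:
  assumes \<sigma>: "\<sigma> 0 = z" "\<sigma> 2 = b" "\<sigma> 4 = A" and A: "conflict_free A"
  shows "chosen_link z b A (run redirect \<sigma> 2)"
proof -
  define c where "c = Choose (Equal (Cell 4 loop_e) (Num 0)) Nop (Store 2 (target_ex 4 loop_e) loop_e)"
  let ?Inv = "\<lambda>k \<tau>. (\<forall>e<k. A e \<noteq> 0 \<longrightarrow> \<tau> 2 (endpoint z e (A e)) = e) \<and>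
     (\<forall>v. \<tau> 2 v = b v \<or> (\<tau> 2 v < z 2 \<and> A (\<tau> 2 v) \<noteq> 0 \<and> v = endpoint z (\<tau> 2 v) (A (\<tau> 2 v))))"
  have "?Inv (\<sigma> 0 2) (run redirect \<sigma>)"
    unfolding redirect_def c_def[symmetric]
  proof (rule run_Loop_invariant[where Inv = ?Inv])
    show "admissible (Loop 12 2 c)" by (simp add: c_def)
    show "?Inv 0 (\<sigma>(12 := (\<sigma> 12)(0 := 0)))" using \<sigma> by simp
  next
    fix k \<tau>
    assume k: "k < \<sigma> 0 2" "\<tau> 12 0 = k"
      and same: "\<And>a. a \<notin> writes c \<Longrightarrow> a \<noteq> 12 \<Longrightarrow> \<tau> a = \<sigma> a"
      and inv: "?Inv k \<tau>"
    have \<tau>: "\<tau> 0 = z" "\<tau> 4 = A" using same \<sigma> by (auto simp: c_def)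
    have k': "k < z 2" using k \<sigma> by simp
    have new: "run c \<tau> 2 = (if A k = 0 then \<tau> 2 else (\<tau> 2)(endpoint z k (A k) := k))"
      using \<tau> k by (simp add: c_def)
    have "run c \<tau> 2 (endpoint z e (A e)) = e" if "e < Suc k" "A e \<noteq> 0" for e
    proof (cases "e = k")
      case False
      then have "e < k" using that by simp
      \<comment> \<open>Conflict-freeness enters here: decided links have different targets, so the
        store for \<open>k\<close> does not overwrite an earlier one.\<close>
      moreover have "endpoint z e (A e) \<noteq> endpoint z k (A k)" if "A k \<noteq> 0"
        using conflict_freeD[OF A, of e k] \<open>e < k\<close> k' \<open>A e \<noteq> 0\<close> that by simp
      ultimately show ?thesis using new inv that by simp
    qed (use new that in simp)
    moreover have "run c \<tau> 2 v = b v \<or> (run c \<tau> 2 v < z 2 \<and> A (run c \<tau> 2 v) \<noteq> 0 \<and>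
        v = endpoint z (run c \<tau> 2 v) (A (run c \<tau> 2 v)))" for v
      using new inv k' by (cases "A k \<noteq> 0 \<and> v = endpoint z k (A k)") auto
    ultimately show "?Inv (Suc k) ((run c \<tau>)(12 := (\<tau> 12)(0 := Suc k)))" by simp
  qed
  then show ?thesis using \<sigma> by (simp add: chosen_link_def)
qed

end

lemma run_emit_side:
  assumes "\<sigma> 0 = z" "\<sigma> 2 = g" "\<sigma> 12 0 = j"
  shows "run (emit_side x) \<sigma> 1 =
    (let v = endpoint z j x in
      (\<sigma> 1)(2 * x + 4 * j := if g v = j then budget_num z v else 0,
        Suc (2 * x + 4 * j) := if g v = j then budget_den z v else 1))"
  using assms by (simp add: emit_side_def Let_def)

lemma run_emit:
  assumes \<sigma>: "\<sigma> 0 = z" "\<sigma> 2 = g"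
  shows "emitted z g (z 2) (run emit \<sigma> 1)"
proof -
  define c where "c = emit_side 1 ;; emit_side 2"
  define \<rho> where "\<rho> = run (Store 1 (Num 1) (Num 1)) \<sigma>"
  let ?Inv = "\<lambda>k \<tau>. emitted z g k (\<tau> 1)"
  have "?Inv (\<rho> 0 2) (run (Loop 12 2 c) \<rho>)"
  proof (rule run_Loop_invariant[where Inv = ?Inv])
    show "admissible (Loop 12 2 c)" by (simp add: c_def emit_side_def Let_def)
    show "?Inv 0 (\<rho>(12 := (\<rho> 12)(0 := 0)))" by (simp add: emitted_def \<rho>_def)
  next
    fix k \<tau>
    assume k: "k < \<rho> 0 2" "\<tau> 12 0 = k"
      and same: "\<And>a. a \<notin> writes c \<Longrightarrow> a \<noteq> 12 \<Longrightarrow> \<tau> a = \<rho> a"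
      and inv: "?Inv k \<tau>"
    have \<tau>: "\<tau> 0 = z" "\<tau> 2 = g" using same \<sigma> by (auto simp: c_def \<rho>_def emit_side_def Let_def)
    let ?\<tau> = "run (emit_side 1) \<tau>"
    have \<tau>': "?\<tau> 0 = z" "?\<tau> 2 = g" "?\<tau> 12 0 = k"
      using \<tau> k by (simp_all add: run_unwritten emit_side_def Let_def)
    have new: "run c \<tau> 1 = (\<tau> 1)(
        2 * 1 + 4 * k := if g (endpoint z k 1) = k then budget_num z (endpoint z k 1) else 0,
        Suc (2 * 1 + 4 * k) := if g (endpoint z k 1) = k then budget_den z (endpoint z k 1) else 1,
        2 * 2 + 4 * k := if g (endpoint z k 2) = k then budget_num z (endpoint z k 2) else 0,
        Suc (2 * 2 + 4 * k) := if g (endpoint z k 2) = k then budget_den z (endpoint z k 2) else 1)"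
      unfolding c_def run.simps(3) run_emit_side[OF \<tau>', of 2] run_emit_side[OF \<tau> k(2), of 1] Let_def ..
    have "emitted z g (Suc k) (run c \<tau> 1)"
      unfolding emitted_def
    proof (intro conjI allI impI ballI)
      show "run c \<tau> 1 1 = 1" using inv by (simp add: new[unfolded One_nat_def] emitted_def)
      fix j x :: nat assume j: "j < Suc k" and x: "x \<in> {1, 2}"
      show "let v = endpoint z j x in
          run c \<tau> 1 (2 * x + 4 * j) = (if g v = j then budget_num z v else 0) \<and>
          run c \<tau> 1 (2 * x + 4 * j + 1) = (if g v = j then budget_den z v else 1)"
      proof (cases "j = k")
        case True
        then show ?thesis using x by (auto simp: new[unfolded One_nat_def] Let_def)
      next
        case False
        \<comment> \<open>Earlier links occupy cells below \<open>2 + 4 * k\<close>, where the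
          writes for link \<open>k\<close> begin.\<close>
        then have "2 * x + 4 * j + 1 < 2 + 4 * k" using j x by auto
        then have "run c \<tau> 1 (2 * x + 4 * j) = \<tau> 1 (2 * x + 4 * j)"
            "run c \<tau> 1 (2 * x + 4 * j + 1) = \<tau> 1 (2 * x + 4 * j + 1)"
          by (simp_all add: new[unfolded One_nat_def])
        moreover have "j < k" using False j by simp
        ultimately show ?thesis using inv x by (auto simp: emitted_def Let_def)
      qed
    qed
    then show "?Inv (Suc k) ((run c \<tau>)(12 := (\<tau> 12)(0 := Suc k)))" by simp
  qed
  then show ?thesis using \<sigma> by (simp add: emit_def c_def \<rho>_def)
qed

text \<open>Keeps the program apart from games: the input is any array with positive denominators.
  The 0 in cell 1 of array 1 is the untouched initial value and serves as the negative
  decision.\<close>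

lemma run_solver:
  assumes \<sigma>: "\<sigma> 0 = z" "\<And>a i. a \<noteq> 0 \<Longrightarrow> \<sigma> a i = 0" and den: "\<And>j. j < z 2 \<Longrightarrow> 0 < den z j"
  defines "\<tau> \<equiv> run solver \<sigma>"
  shows "\<tau> 0 = z" and "\<exists>b. best_links z b \<and>
    (\<tau> 6 0 = 0 \<and> (\<exists>A g. two_choice.solution (z 2) (required z b) (endpoint z)
          (\<lambda>e x. \<not> cheaper z e (b (endpoint z e x))) A \<and> chosen_link z b A g \<and> emitted z g (z 2) (\<tau> 1)) \<or>
     \<tau> 6 0 \<noteq> 0 \<and> \<tau> 1 1 = 0 \<and> \<not> (\<exists>A. two_choice.solution (z 2) (required z b) (endpoint z)
          (\<lambda>e x. \<not> cheaper z e (b (endpoint z e x))) A))"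
proof -
  show "\<tau> 0 = z"
    unfolding \<tau>_def using run_unwritten[OF admissible_keeps_input[OF admissible_solver]] \<sigma> by simp
  define \<rho> where "\<rho> = run find_best \<sigma>"
  define b where "b = \<rho> 2"
  define \<rho>' where "\<rho>' = run (Loop 10 2 assign_link) \<rho>"
  have \<rho>: "\<rho> 0 = z" "\<rho> 2 = b" "\<And>j. \<rho> 4 j = 0" "\<rho> 6 0 = 0" "\<rho> 1 1 = 0"
    using \<sigma> by (simp_all add: \<rho>_def b_def)
  have \<rho>': "\<rho>' a = \<rho> a" if "a \<notin> {4, 5, 6, 7, 10, 11, 12, 13}" for a
    unfolding \<rho>'_def by (rule run_unwritten) (use that in simp)
  have \<rho>'0: "\<rho>' 0 = z" "\<rho>' 2 = b" "\<rho>' 1 1 = 0" using \<rho> \<rho>' by auto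
  have \<tau>: "\<tau> = (if \<rho>' 6 0 = 0 then run emit (run redirect \<rho>') else \<rho>')"
    by (simp add: \<tau>_def solver_def \<rho>'_def \<rho>_def del: run.simps(5))
  interpret solver_run z b .
  note sol = run_assign_all[OF \<rho>(1-4), folded \<rho>'_def]
  have best: "best_links z b"
    unfolding b_def \<rho>_def using \<sigma>(1) den by (rule run_find_best)
  show "\<exists>b. best_links z b \<and>
    (\<tau> 6 0 = 0 \<and> (\<exists>A g. two_choice.solution (z 2) (required z b) (endpoint z)
          (\<lambda>e x. \<not> cheaper z e (b (endpoint z e x))) A \<and> chosen_link z b A g \<and> emitted z g (z 2) (\<tau> 1)) \<or>
     \<tau> 6 0 \<noteq> 0 \<and> \<tau> 1 1 = 0 \<and> \<not> (\<exists>A. two_choice.solution (z 2) (required z b) (endpoint z)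
          (\<lambda>e x. \<not> cheaper z e (b (endpoint z e x))) A))"
  proof (intro exI[of _ b] conjI best)
    show "\<tau> 6 0 = 0 \<and> (\<exists>A g. solution A \<and> chosen_link z b A g \<and> emitted z g (z 2) (\<tau> 1)) \<or>
     \<tau> 6 0 \<noteq> 0 \<and> \<tau> 1 1 = 0 \<and> \<not> (\<exists>A. solution A)"
    proof (cases "\<rho>' 6 0 = 0")
      case True
      let ?\<rho> = "run redirect \<rho>'"
      have "chosen_link z b (\<rho>' 4) (?\<rho> 2)"
        using sol(1)[OF True] \<rho>'0 by (intro run_redirect) (simp_all add: solution_def)
      moreover have "emitted z (?\<rho> 2) (z 2) (\<tau> 1)"
        using True \<rho>'0 run_emit[of ?\<rho> z "?\<rho> 2"] by (simp add: \<tau>)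
      moreover have "\<tau> 6 0 = 0" using True by (simp add: \<tau>)
      ultimately show ?thesis using sol(1)[OF True] by blast
    next
      case False
      then show ?thesis using sol(2) \<rho>'0 by (simp add: \<tau>)
    qed
  qed
qed

section \<open>Instances and their encodings\<close>

lemma length_concat_blocks: "(\<And>x. x \<in> set xs \<Longrightarrow> length (f x) = k) \<Longrightarrow> length (concat (map f xs)) = k * length xs"
  by (induction xs) auto

lemma nth_concat_blocks:
  assumes "\<And>x. x \<in> set xs \<Longrightarrow> length (f x) = k" "i < length xs" "r < k"
  shows "concat (map f xs) ! (k * i + r) = f (xs ! i) ! r"
  using assms
proof (induction xs arbitrary: i)
  case (Cons x xs)
  then show ?case by (cases i) (auto simp: nth_append)
qed simp

lemma concat_blocks_upt: "concat (map (\<lambda>j. map h [k * j..<k * Suc j]) [0..<m]) = map h [0..<k * m]"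
proof (induction m)
  case (Suc m)
  have "[0..<k * Suc m] = [0..<k * m] @ [k * m..<k * Suc m]"
    using upt_add_eq_append[of 0 "k * m" k] by (simp add: add.commute)
  with Suc show ?case by simp
qed simp

lemma length_encode_rat [simp]: "length (encode_rat q) = 2"
  by (simp add: encode_rat_def split: prod.split)

lemma encode_rat_zero: "encode_rat 0 = [0, 1]"
  by (simp add: encode_rat_def)

lemma encode_rat_split: "encode_rat q ! 0 = a \<Longrightarrow> encode_rat q ! 1 = d \<Longrightarrow> encode_rat q = [a, d]"
  by (auto simp: encode_rat_def split: prod.splits)

text \<open>The conversion by \<open>nat\<close> in \<open>encode_rat\<close> loses nothing here, as
  a nonnegative rational has a nonnegative numerator over a positive denominator.\<close>

lemma encode_rat_pos:
  assumes "0 \<le> q"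
  shows "0 < encode_rat q ! 1" and "real_of_rat q = real (encode_rat q ! 0) / real (encode_rat q ! 1)"
proof -
  obtain a d where q: "quotient_of q = (a, d)" by fastforce
  have d: "0 < d" using quotient_of_denom_pos[OF q] .
  have "q = of_int a / of_int d" using quotient_of_div[OF q] .
  moreover from this assms d have "0 \<le> a" by (simp add: zero_le_divide_iff)
  ultimately show "0 < encode_rat q ! 1"
      and "real_of_rat q = real (encode_rat q ! 0) / real (encode_rat q ! 1)"
    using q d by (simp_all add: encode_rat_def of_rat_divide)
qed

definition input_array :: "linear_instance \<Rightarrow> nat \<Rightarrow> nat" where
  "input_array I = input_memory (encode_instance I) 0"

locale instance_input =
  fixes I :: linear_instance
  assumes valid: "valid_instance I"
begin

definition "n = length (budgets I)"
definition "m = length (links I)"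
definition "z = input_array I"

definition link :: "nat \<Rightarrow> nat set" where
  "link j = {endpoint z j 1, endpoint z j 2}"

lemma z_Suc: "i < length (encode_instance I) \<Longrightarrow> z (Suc i) = encode_instance I ! i"
  by (simp add: z_def input_array_def input_memory_def)

definition "budget_codes = concat (map encode_rat (budgets I))"
definition "link_codes = concat (map (\<lambda>(u, v, c). [u, v] @ encode_rat c) (links I))"

lemma length_codes: "length budget_codes = 2 * n" "length link_codes = 4 * m"
proof -
  have "length (case l of (u, v, c) \<Rightarrow> [u, v] @ encode_rat c) = 4" for l
    by (cases l) simp
  then show "length link_codes = 4 * m" unfolding m_def link_codes_def by (intro length_concat_blocks)
  show "length budget_codes = 2 * n" unfolding n_def budget_codes_def by (intro length_concat_blocks) simp
qed

lemma encode_instance_eq: "encode_instance I = [n, m] @ budget_codes @ link_codes"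
  by (simp add: encode_instance_def n_def m_def budget_codes_def link_codes_def)

lemma length_encode: "length (encode_instance I) = 2 + 2 * n + 4 * m"
  by (simp add: encode_instance_eq length_codes)

lemma z_codes:
  assumes "i < 2 * n + 4 * m" shows "z (3 + i) = (budget_codes @ link_codes) ! i"
proof -
  have "Suc (Suc i) < length (encode_instance I)" using assms length_encode by linarith
  from z_Suc[OF this] have "z (3 + i) = encode_instance I ! Suc (Suc i)" by (simp add: numeral_3_eq_3)
  also have "\<dots> = (budget_codes @ link_codes) ! i" unfolding encode_instance_eq by simp
  finally show ?thesis .
qed

lemma sizes: "z 1 = n" "z 2 = m"
proof -
  have "0 < length (encode_instance I)" "Suc 0 < length (encode_instance I)"
    using length_encode by linarith+
  from this[THEN z_Suc] have "z 1 = encode_instance I ! 0" "z 2 = encode_instance I ! Suc 0"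
    by (simp_all add: numeral_2_eq_2)
  then show "z 1 = n" "z 2 = m" unfolding encode_instance_eq by simp_all
qed

lemma z_budget:
  assumes "v < n" "r < 2" shows "z (3 + (2 * v + r)) = encode_rat (budgets I ! v) ! r"
proof -
  have "2 * v + r < 2 * n" using assms by linarith
  then have "z (3 + (2 * v + r)) = budget_codes ! (2 * v + r)"
    by (subst z_codes) (simp_all add: nth_append length_codes)
  also have "\<dots> = encode_rat (budgets I ! v) ! r"
    unfolding budget_codes_def using assms by (intro nth_concat_blocks) (auto simp: n_def)
  finally show ?thesis .
qed

lemma z_link:
  assumes "j < m" "r < 4"
  shows "z (3 + (2 * n + (4 * j + r))) = (case links I ! j of (u, v, c) \<Rightarrow> [u, v] @ encode_rat c) ! r"
proof -
  have "4 * j + r < 4 * m" using assms by linarith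
  then have "z (3 + (2 * n + (4 * j + r))) = link_codes ! (4 * j + r)"
    by (subst z_codes) (simp_all add: nth_append length_codes)
  also have "\<dots> = (case links I ! j of (u, v, c) \<Rightarrow> [u, v] @ encode_rat c) ! r"
    unfolding link_codes_def using assms by (intro nth_concat_blocks) (auto simp: m_def)
  finally show ?thesis .
qed

lemma budget_code: "v < n \<Longrightarrow> encode_rat (budgets I ! v) = [budget_num z v, budget_den z v]"
  using z_budget[of v 0] z_budget[of v 1]
  by (intro encode_rat_split) (simp_all add: budget_num_def budget_den_def)

lemma link_code:
  assumes "j < m"
  shows "\<exists>c. links I ! j = (endpoint z j 1, endpoint z j 2, c) \<and> encode_rat c = [num z j, den z j]"
proof -
  obtain u v c where l: "links I ! j = (u, v, c)" by (metis prod_cases3)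
  have "endpoint z j 1 = u" "endpoint z j 2 = v" "num z j = encode_rat c ! 0" "den z j = encode_rat c ! 1"
    using z_link[OF assms, of 0] z_link[OF assms, of 1] z_link[OF assms, of 2] z_link[OF assms, of 3]
    by (simp_all add: l endpoint_def num_def den_def sizes[unfolded One_nat_def] eval_nat_numeral)
  moreover from this have "encode_rat c = [num z j, den z j]" by (intro encode_rat_split) simp_all
  ultimately show ?thesis using l by blast
qed

lemma link_valid:
  assumes "j < m"
  shows "endpoint z j 1 < n" "endpoint z j 2 < n" "endpoint z j 1 \<noteq> endpoint z j 2"
    and "0 < num z j" "0 < den z j" "links I ! j = (endpoint z j 1, endpoint z j 2, c) \<Longrightarrow> real_of_rat c = coeff z j"
proof -
  obtain c' where c: "links I ! j = (endpoint z j 1, endpoint z j 2, c')" "encode_rat c' = [num z j, den z j]"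
    using link_code[OF assms] by blast
  have "links I ! j \<in> set (links I)" using assms by (simp add: m_def)
  then have *: "endpoint z j 1 < n" "endpoint z j 2 < n" "endpoint z j 1 \<noteq> endpoint z j 2" "0 < c'"
    using valid c(1) by (fastforce simp: valid_instance_def n_def)+
  then show "endpoint z j 1 < n" "endpoint z j 2 < n" "endpoint z j 1 \<noteq> endpoint z j 2" by auto
  have c': "0 < den z j" "real_of_rat c' = coeff z j"
    using encode_rat_pos[of c'] *(4) c(2) by (simp_all add: coeff_def)
  then show "0 < den z j" by simp
  have "0 < coeff z j" using c'(2) *(4) by (metis zero_less_of_rat_iff)
  then show "0 < num z j" by (simp add: coeff_def zero_less_divide_iff)
  show "real_of_rat c = coeff z j" if "links I ! j = (endpoint z j 1, endpoint z j 2, c)"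
    using that c(1) c'(2) by simp
qed

abbreviation "G \<equiv> game_of I"

lemma link_eq: "j < m \<Longrightarrow> (case links I ! j of (u, v, c) \<Rightarrow> {u, v}) = link j"
proof -
  assume "j < m"
  then obtain c where "links I ! j = (endpoint z j 1, endpoint z j 2, c)" using link_code by blast
  then show ?thesis by (simp add: link_def)
qed

lemma edges_eq: "edges G = link ` {..<m}"
proof -
  have "set (links I) = (!) (links I) ` {..<m}" by (auto simp: m_def set_conv_nth)
  then have "edges G = (\<lambda>j. (\<lambda>(u, v, c). {u, v}) (links I ! j)) ` {..<m}"
    by (simp add: game_of_def image_image)
  also have "\<dots> = link ` {..<m}"
    by (intro image_cong refl) (simp add: link_eq)
  finally show ?thesis .
qed

lemma link_inj: "i < m \<Longrightarrow> j < m \<Longrightarrow> link i = link j \<longleftrightarrow> i = j"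
proof -
  assume ij: "i < m" "j < m"
  have "map (\<lambda>(u, v, c). {u, v}) (links I) ! j = link j" if "j < m" for j
    using link_eq[OF that] that by (simp add: m_def)
  then show ?thesis
    using ij valid nth_eq_iff_index_eq[of "map (\<lambda>(u, v, c). {u, v}) (links I)" i j]
    by (simp add: valid_instance_def m_def)
qed

text \<open>The links are distinct as sets, so the lookup by \<open>map_of\<close> finds the entry
  of exactly this link.\<close>

lemma coefficient_link: "j < m \<Longrightarrow> real_of_rat (coefficient I (link j)) = coeff z j"
proof -
  assume j: "j < m"
  obtain c where c: "links I ! j = (endpoint z j 1, endpoint z j 2, c)" using link_code[OF j] by blast
  let ?xs = "map (\<lambda>(u, v, c). ({u, v}, c)) (links I)"
  have "distinct (map fst ?xs)"
    using valid by (simp add: valid_instance_def case_prod_unfold comp_def)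
  moreover have "(link j, c) \<in> set ?xs"
    using j c nth_mem[of j ?xs] by (simp add: m_def link_def)
  ultimately have "coefficient I (link j) = c" by (simp add: coefficient_def)
  then show ?thesis using link_valid(6)[OF j c] by simp
qed

lemma is_end_iff: "is_end z v j \<longleftrightarrow> v \<in> link j"
  by (simp add: is_end_def link_def)

end

sublocale instance_input \<subseteq> linear_game "game_of I" "\<lambda>e. real_of_rat (coefficient I e)"
proof
  show "contribution_game G" using game_of_linear[OF valid] by (simp add: linear_games_def)
  show "0 < real_of_rat (coefficient I e)" if "e \<in> edges G" for e
  proof -
    from that obtain j where j: "j < m" "e = link j" by (auto simp: edges_eq)
    have "0 < coeff z j" using link_valid(4,5)[OF j(1)] by (simp add: coeff_def)
    then show ?thesis by (simp only: j(2) coefficient_link[OF j(1)])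
  qed
qed (simp add: game_of_def)

context instance_input
begin

lemma nodes_eq: "nodes G = {..<n}"
  by (simp add: game_of_def n_def)

lemma budget_pos:
  assumes v: "v < n" shows "0 < budget G v \<longleftrightarrow> 0 < budget_num z v"
proof -
  from v have nonneg: "0 \<le> budgets I ! v" using valid by (simp add: valid_instance_def n_def)
  have "budget G v = real (budget_num z v) / real (budget_den z v)"
    using encode_rat_pos[OF nonneg] budget_code[OF v] by (simp add: game_of_def)
  then show "0 < budget G v \<longleftrightarrow> 0 < budget_num z v"
    using encode_rat_pos(1)[OF nonneg] budget_code[OF v] by (simp add: zero_less_divide_iff)
qed

lemma incident_eq: "incident_edges G v = link ` {j. j < m \<and> is_end z v j}"
  by (auto simp: incident_edges_def edges_eq is_end_iff)

end

section \<open>Equilibria of an instance and solutions of its choice problem\<close>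

locale instance_best = instance_input +
  fixes b
  assumes best: "best_links z b"

sublocale instance_best \<subseteq> choice: solver_run z b .

context instance_best
begin

lemma best_link: "j < m \<Longrightarrow> is_end z v j \<Longrightarrow> b v < m \<and> is_end z v (b v) \<and> coeff z j \<le> coeff z (b v)"
  using best by (simp add: best_links_def sizes)

lemma top_eq: "j < m \<Longrightarrow> is_end z v j \<Longrightarrow> top v = coeff z (b v)"
proof -
  assume j: "j < m" "is_end z v j"
  note b = best_link[OF this]
  have "Max ((\<lambda>e. real_of_rat (coefficient I e)) ` incident_edges G v) = coeff z (b v)"
    using b best_link coefficient_link by (intro Max_eqI) (auto simp: incident_eq image_iff intro!: exI[of _ "b v"])
  then show ?thesis using j by (auto simp: top_def incident_eq)
qed

lemma required_iff:
  assumes j: "j < m" and uv: "u = endpoint z j 1" "v = endpoint z j 2"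
  shows "required z b j \<longleftrightarrow> 0 < budget G u \<and> 0 < budget G v \<and>
    top u * top v < real_of_rat (coefficient I (link j)) * (top u + top v)"
proof -
  have ends: "is_end z u j" "is_end z v j" using uv by (auto simp: is_end_def)
  have nodes: "u < n" "v < n" using link_valid[OF j] uv by auto
  have bs: "b u < m" "b v < m" using best_link j ends by auto
  \<comment> \<open>Both sides share the factor \<open>q * s\<close> in their denominators, which
    cancels; only \<open>d\<close> moves across.\<close>
  have frac: "p / q * (r / s) < a / d * (p / q + r / s) \<longleftrightarrow> p * r * d < a * (p * s + r * q)"
    if "0 < q" "0 < s" "0 < d" for p q r s a d :: real
  proof -
    have "p / q * (r / s) = p * r / (q * s)"
        "a / d * (p / q + r / s) = a * (p * s + r * q) / (d * (q * s))"
      using that by (simp_all add: add_frac_eq)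
    moreover have "x / w < y / (d * w) \<longleftrightarrow> x * d < y" if "0 < w" for x y w :: real
      using that \<open>0 < d\<close> by (simp add: field_simps)
    ultimately show ?thesis using that by simp
  qed
  have "top u * top v < real_of_rat (coefficient I (link j)) * (top u + top v) \<longleftrightarrow>
      real (num z (b u)) * real (num z (b v)) * real (den z j) <
      real (num z j) * (real (num z (b u)) * real (den z (b v)) + real (num z (b v)) * real (den z (b u)))"
    unfolding top_eq[OF j ends(1)] top_eq[OF j ends(2)] coefficient_link[OF j] coeff_def
    using link_valid(5)[OF bs(1)] link_valid(5)[OF bs(2)] link_valid(5)[OF j] by (intro frac) simp_all
  also have "\<dots> \<longleftrightarrow>
      num z (b u) * num z (b v) * den z j < num z j * (num z (b u) * den z (b v) + num z (b v) * den z (b u))"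
    unfolding of_nat_mult[symmetric] of_nat_add[symmetric] of_nat_less_iff ..
  finally have "top u * top v < real_of_rat (coefficient I (link j)) * (top u + top v) \<longleftrightarrow>
      num z (b u) * num z (b v) * den z j < num z j * (num z (b u) * den z (b v) + num z (b v) * den z (b u))" .
  then show ?thesis
    unfolding required_def Let_def using budget_pos nodes uv by auto
qed

lemma cheaper_best_iff:
  "j < m \<Longrightarrow> is_end z v j \<Longrightarrow> cheaper z j (b v) \<longleftrightarrow> real_of_rat (coefficient I (link j)) < top v"
  using best_link[of j v] link_valid(5) by (simp add: cheaper_iff coefficient_link top_eq)

text \<open>Choose for each required link an end that spends its whole budget there. It is permitted
  because a node in equilibrium puts nothing on cheaper edges, and ends are not repeated by
  \<open>two_full\<close>.\<close>

lemma equilibrium_solution: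
  assumes eq: "pairwise_equilibrium G s"
  shows "\<exists>t. choice.solution t"
proof -
  have s: "s \<in> states G" "v < n \<Longrightarrow> own v (s v) = top v * budget G v" for v
    using eq by (auto simp: pairwise_equilibrium_def nash_iff nodes_eq)
  \<comment> \<open>Side 1 is preferred; if it does not spend everything on the link,
    \<open>contested_edge\<close> guarantees that side 2 does.\<close>
  define t where "t j = (if required z b j
     then if s (endpoint z j 1) (link j) = budget G (endpoint z j 1) then 1 else 2 else (0::nat))" for j
  have t: "is_end z (endpoint z j (t j)) j \<and> 0 < budget G (endpoint z j (t j)) \<and>
      s (endpoint z j (t j)) (link j) = budget G (endpoint z j (t j))"
    if j: "j < m" and "required z b j" for j
  proof -
    let ?u = "endpoint z j 1" and ?v = "endpoint z j 2"
    have r: "0 < budget G ?u" "0 < budget G ?v"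
        "top ?u * top ?v < real_of_rat (coefficient I (link j)) * (top ?u + top ?v)"
      using required_iff[OF j refl refl] that(2) by auto
    have "{?u, ?v} \<in> edges G" using j by (auto simp: edges_eq link_def)
    from contested_edge[OF eq this r(1,2)] r(3)
    have "s ?u (link j) = budget G ?u \<or> s ?v (link j) = budget G ?v" by (simp add: link_def)
    then show ?thesis using r(1,2) that(2) by (auto simp: t_def is_end_def)
  qed
  have inc: "link j \<in> incident_edges G v" if "j < m" "is_end z v j" for j v
    using that by (auto simp: incident_eq)
  have node: "v < n" if "j < m" "is_end z v j" for j v
    using that link_valid(1,2)[of j] by (auto simp: is_end_def)
  have "choice.partial t" by (simp add: choice.partial_def t_def)
  moreover have "choice.conflict_free t"
    unfolding choice.conflict_free_def unfolding sizes
  proof (intro allI impI conjI)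
    fix e assume e: "e < m" "t e \<noteq> 0"
    let ?v = "endpoint z e (t e)"
    have te: "is_end z ?v e" "0 < budget G ?v" "s ?v (link e) = budget G ?v"
      using t[OF e(1)] e(2) by (auto simp: t_def split: if_splits)
    have v: "?v < n" using node[OF e(1) te(1)] .
    have strat: "s ?v \<in> strategies G ?v" using statesD[OF s(1)] v by (simp add: nodes_eq)
    show "\<not> cheaper z e (b ?v)"
    proof
      assume "cheaper z e (b ?v)"
      then have "real_of_rat (coefficient I (link e)) < top ?v"
        using cheaper_best_iff[OF e(1) te(1)] by simp
      from own_top_cheap[OF strat s(2)[OF v] inc[OF e(1) te(1)] this] te(2,3)
      show False by simp
    qed
    fix f assume f: "f < m" "e \<noteq> f" "t f \<noteq> 0"
    show "endpoint z e (t e) \<noteq> endpoint z f (t f)"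
    proof
      assume same: "endpoint z e (t e) = endpoint z f (t f)"
      have tf: "is_end z ?v f" "s ?v (link f) = budget G ?v"
        unfolding same using t[OF f(1)] f(3) by (auto simp: t_def split: if_splits)
      have "link e \<noteq> link f" using link_inj e(1) f(1,2) by simp
      from two_full[OF strat inc[OF e(1) te(1)] inc[OF f(1) tf(1)] this te(3) tf(2)] te(2)
      show False by simp
    qed
  qed
  ultimately show ?thesis
    unfolding choice.solution_def by (intro exI[of _ t]) (simp add: t_def)
qed

text \<open>A redirected node goes to a permitted link, one no cheaper than \<open>b v\<close>; as
  no incident link exceeds the maximum, it is again a best one.\<close>

lemma chosen_valid:
  assumes A: "choice.solution A" and g: "chosen_link z b A g" and j: "j < m" "is_end z v j"
  shows "g v < m" "is_end z v (g v)" "real_of_rat (coefficient I (link (g v))) = top v"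
proof -
  have b: "b v < m" "is_end z v (b v)" "coeff z (b v) = top v"
    using best_link[OF j] top_eq[OF j] by auto
  have "g v < m \<and> is_end z v (g v) \<and> real_of_rat (coefficient I (link (g v))) = top v"
  proof (cases "g v = b v")
    case True
    then show ?thesis using b coefficient_link by simp
  next
    case False
    then have e: "g v < m" "A (g v) \<noteq> 0" "v = endpoint z (g v) (A (g v))"
      using g by (auto simp: chosen_link_def sizes)
    then have "A (g v) = 1 \<or> A (g v) = 2" using choice.solution_values[OF A, of "g v"] sizes by simp
    then have v: "is_end z v (g v)" using e(3) unfolding is_end_def by metis
    have "\<not> cheaper z (g v) (b v)"
      using A e unfolding choice.solution_def choice.conflict_free_def unfolding sizes by metis
    then have "top v \<le> real_of_rat (coefficient I (link (g v)))"
      using cheaper_best_iff[OF e(1) v] by simp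
    moreover have "real_of_rat (coefficient I (link (g v))) \<le> top v"
      using e(1) v by (intro top_ge) (auto simp: incident_eq)
    ultimately show ?thesis using e(1) v by simp
  qed
  then show "g v < m" "is_end z v (g v)" "real_of_rat (coefficient I (link (g v))) = top v" by auto
qed

lemma solution_equilibrium:
  assumes A: "choice.solution A" and g: "chosen_link z b A g"
  shows "pairwise_equilibrium G (\<lambda>v e. if e = link (g v) then budget G v else 0)"
proof (rule concentrated_equilibrium)
  show "link (g v) \<in> incident_edges G v \<and> real_of_rat (coefficient I (link (g v))) = top v"
    if "v \<in> nodes G" and inc: "incident_edges G v \<noteq> {}" for v
  proof -
    from inc obtain j where j: "j < m" "is_end z v j" by (auto simp: incident_eq)
    show ?thesis using chosen_valid[OF A g j] by (auto simp: incident_eq)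
  qed
  show "link (g u) = {u, v} \<or> link (g v) = {u, v}"
    if "{u, v} \<in> edges G" and B: "0 < budget G u" "0 < budget G v"
      and c: "top u * top v < real_of_rat (coefficient I {u, v}) * (top u + top v)" for u v
  proof -
    from that(1) obtain j where j: "j < m" "{u, v} = link j" by (auto simp: edges_eq)
    let ?x = "endpoint z j 1" and ?y = "endpoint z j 2"
    have uv: "u = ?x \<and> v = ?y \<or> u = ?y \<and> v = ?x"
      using j(2) by (auto simp: link_def doubleton_eq_iff)
    \<comment> \<open>The edge is an unordered pair, while \<open>required_iff\<close> fixes the
      order of the ends; both ways of matching them are treated.\<close>
    then have "required z b j"
    proof (elim disjE conjE)
      assume "u = ?x" "v = ?y"
      with required_iff[OF j(1) this] B c j(2) show ?thesis by simp
    next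
      assume "u = ?y" "v = ?x"
      moreover have "top v * top u < real_of_rat (coefficient I (link j)) * (top v + top u)"
        using c unfolding j(2) by (simp only: mult.commute[of "top v" "top u"] add.commute[of "top v" "top u"])
      ultimately show ?thesis using required_iff[of j v u] j(1) B by simp
    qed
    then have nz: "A j \<noteq> 0" using A j(1) unfolding choice.solution_def by (simp add: sizes)
    then have "g (endpoint z j (A j)) = j" using g j(1) by (simp add: chosen_link_def sizes)
    moreover have "A j = 1 \<or> A j = 2"
      by (rule choice.solution_values[OF A _ nz]) (simp add: sizes j(1))
    then have "endpoint z j (A j) = u \<or> endpoint z j (A j) = v" using uv by metis
    ultimately show ?thesis unfolding j(2) by metis
  qed
qed

definition rational_state :: "(nat \<Rightarrow> nat) \<Rightarrow> nat \<Rightarrow> nat set \<Rightarrow> rat" where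
  "rational_state g v e = (if e = link (g v) then budgets I ! v else 0)"

lemma rational_state_equilibrium:
  assumes "choice.solution A" "chosen_link z b A g"
  shows "pairwise_equilibrium G (\<lambda>v e. of_rat (rational_state g v e))"
proof -
  have "(\<lambda>v e. real_of_rat (rational_state g v e)) = (\<lambda>v e. if e = link (g v) then budget G v else 0)"
    by (intro ext) (simp add: rational_state_def game_of_def)
  then show ?thesis using solution_equilibrium[OF assms] by simp
qed

lemma emitted_encoding:
  assumes A: "choice.solution A" and g: "chosen_link z b A g" and out: "emitted z g m out"
  shows "map (\<lambda>i. out (2 + i)) [0..<4 * m] = encode_state I (rational_state g)"
proof -
  have side: "encode_rat (rational_state g v (link j)) = [out (2 * x + 4 * j), out (2 * x + 4 * j + 1)]"
    if j: "j < m" and x: "x \<in> {1, 2}" and v: "v = endpoint z j x" for j x v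
  proof -
    have "is_end z v j" "v < n" using x v link_valid(1,2)[OF j] by (auto simp: is_end_def)
    \<comment> \<open>\<open>link\<close> is injective on indices below \<open>m\<close>, so
      \<open>g v < m\<close> is supplied by \<open>chosen_valid\<close>.\<close>
    then have "link j = link (g v) \<longleftrightarrow> g v = j"
      using chosen_valid(1)[OF A g j] link_inj[OF j] by auto
    then have "rational_state g v (link j) = (if g v = j then budgets I ! v else 0)"
      by (simp add: rational_state_def)
    moreover have "out (2 * x + 4 * j) = (if g v = j then budget_num z v else 0)"
        "out (2 * x + 4 * j + 1) = (if g v = j then budget_den z v else 1)"
      using out j x v by (auto simp: emitted_def Let_def)
    ultimately show ?thesis
      using budget_code[OF \<open>v < n\<close>] encode_rat_zero by simp
  qed
  have "(case links I ! j of (u, v, c) \<Rightarrow>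
      encode_rat (rational_state g u {u, v}) @ encode_rat (rational_state g v {u, v})) =
      map (\<lambda>i. out (2 + i)) [4 * j..<4 * Suc j]" if j: "j < m" for j
  proof -
    obtain c where "links I ! j = (endpoint z j 1, endpoint z j 2, c)" using link_code[OF j] by blast
    moreover have "[k..<k + 4] = [k, k + 1, k + 2, k + 3]" for k :: nat
      by (simp add: upt_conv_Cons eval_nat_numeral)
    then have "[4 * j..<4 * Suc j] = [4 * j, 4 * j + 1, 4 * j + 2, 4 * j + 3]"
      by (metis mult_Suc_right add.commute)
    ultimately show ?thesis
      using side[OF j, of 1] side[OF j, of 2] by (simp add: eval_nat_numeral link_def)
  qed
  then have "map (\<lambda>j. case links I ! j of (u, v, c) \<Rightarrow>
      encode_rat (rational_state g u {u, v}) @ encode_rat (rational_state g v {u, v})) [0..<m] =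
      map (\<lambda>j. map (\<lambda>i. out (2 + i)) [4 * j..<4 * Suc j]) [0..<m]"
    by (intro map_cong) auto
  moreover have "map f (links I) = map (\<lambda>j. f (links I ! j)) [0..<m]" for f :: "nat \<times> nat \<times> rat \<Rightarrow> nat list"
    unfolding m_def by (rule nth_equalityI) auto
  ultimately show ?thesis
    unfolding encode_state_def by (simp only: concat_blocks_upt)
qed

end

text \<open>The length \<open>1 + 4 * m\<close> of a positive answer is neither a copy nor a small
  constant, so it is written by plain commands after the compiled program. In the negative case the
  length 1 exposes only the 0 in cell 1.\<close>

definition algorithm :: com where
  "algorithm = Seq (compile solver)
     (Cond (Equal (Cell 6 (Num 0)) (Num 0))
       (Assign 1 (Num 0) (Plus (Num 1) (Times (Num 4) (Cell 0 (Num 2)))))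
       (Assign 1 (Num 0) (Num 1)))"

lemma output_list_Suc: "\<sigma> 1 0 = Suc k \<Longrightarrow> output_list \<sigma> = \<sigma> 1 1 # map (\<lambda>i. \<sigma> 1 (2 + i)) [0..<k]"
  by (simp add: output_list_def upt_conv_Cons map_Suc_upt[symmetric] comp_def del: upt_Suc)

lemma (in instance_input) solver_answer:
  defines "\<tau> \<equiv> run solver (input_memory (encode_instance I))"
  shows "equilibrium_answer I
    (output_list (\<tau>(1 := (\<tau> 1)(0 := if \<tau> 6 0 = 0 then 1 + 4 * \<tau> 0 2 else 1))))"
proof -
  have z: "input_memory (encode_instance I) 0 = z" "a \<noteq> 0 \<Longrightarrow> input_memory (encode_instance I) a i = 0" for a i
    by (simp_all add: z_def input_array_def) (simp add: input_memory_def)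
  have den: "0 < den z j" if "j < z 2" for j using link_valid(5) that by (simp add: sizes)
  from run_solver(2)[of "input_memory (encode_instance I)" z, OF z den, folded \<tau>_def]
  obtain b where b: "best_links z b" and cases:
    "\<tau> 6 0 = 0 \<and> (\<exists>A g. two_choice.solution (z 2) (required z b) (endpoint z)
          (\<lambda>e x. \<not> cheaper z e (b (endpoint z e x))) A \<and> chosen_link z b A g \<and> emitted z g (z 2) (\<tau> 1)) \<or>
     \<tau> 6 0 \<noteq> 0 \<and> \<tau> 1 1 = 0 \<and> \<not> (\<exists>A. two_choice.solution (z 2) (required z b) (endpoint z)
          (\<lambda>e x. \<not> cheaper z e (b (endpoint z e x))) A)"
    by blast
  interpret instance_best I b by unfold_locales (rule b)
  show ?thesis
  proof (cases "\<tau> 6 0 = 0")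
    case True
    with cases obtain A g where A: "choice.solution A" "chosen_link z b A g" and out: "emitted z g m (\<tau> 1)"
      by (auto simp: sizes)
    have "\<tau> 0 = z" unfolding \<tau>_def using z den by (rule run_solver(1))
    then have len: "\<tau> 0 2 = m" by (simp add: sizes)
    have "output_list (\<tau>(1 := (\<tau> 1)(0 := 1 + 4 * \<tau> 0 2))) = \<tau> 1 1 # map (\<lambda>i. \<tau> 1 (2 + i)) [0..<4 * m]"
      by (subst output_list_Suc[where k = "4 * m"]) (use len in simp_all)
    also have "\<dots> = 1 # encode_state I (rational_state g)"
      using out by (simp only: emitted_encoding[OF A out]) (simp add: emitted_def)
    finally show ?thesis
      using rational_state_equilibrium[OF A] True by (auto simp: equilibrium_answer_def)
  next
    case False
    with cases have "\<tau> 1 1 = 0" "\<nexists>s. pairwise_equilibrium G s"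
      using equilibrium_solution by auto
    then show ?thesis
      using False by (simp add: equilibrium_answer_def output_list_Suc[where k = 0])
  qed
qed

section \<open>Polynomial running time\<close>

lemma bit_length_ge: "1 \<le> bit_length x" "x < 2 ^ bit_length x"
  using floor_log_exp2_gt[of x] by (simp_all add: bit_length_def)

lemma length_le_input_size: "length xs \<le> input_size xs"
proof (induction xs)
  case (Cons x xs)
  then show ?case using bit_length_ge(1)[of x] by (simp add: input_size_def)
qed (simp add: input_size_def)

lemma input_below:
  assumes "xs ! 0 \<le> input_size xs" "xs ! 1 \<le> input_size xs" "2 \<le> length xs"
  shows "below (input_size xs + 2) (input_memory xs)"
proof -
  let ?L = "input_size xs + 2"
  have "x < 2 ^ ?L" if "x \<in> set xs" for x
  proof -
    have "bit_length x \<le> input_size xs"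
      unfolding input_size_def using that by (intro member_le_sum_list) auto
    then have "(2::nat) ^ bit_length x \<le> 2 ^ ?L" by (intro power_increasing) auto
    with bit_length_ge(2)[of x] show ?thesis by linarith
  qed
  moreover have "length xs < 2 ^ ?L"
    using length_le_input_size[of xs] less_exp[of ?L] by linarith
  ultimately show ?thesis
    using assms by (auto simp: below_def input_memory_def numeral_2_eq_2)
qed

lemma algorithm_poly_time:
  "poly_time_solves algorithm encode_instance {I. valid_instance I} equilibrium_answer"
proof -
  obtain p where p: "\<And>L. cost solver L = poly p L" using cost_polynomial by blast
  let ?test = "Equal (Cell 6 (Num 0)) (Num 0)"
  let ?len = "Plus (Num 1) (Times (Num 4) (Cell 0 (Num 2)))"
  let ?w = "bweight ?test + aweight (Num 0) + aweight ?len + aweight (Num 1)"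
  \<comment> \<open>Substitutes \<open>k + 2\<close> for \<open>L\<close>, the bound on the initial
    memory, after adding the cost of the final commands.\<close>
  define q where "q = pcompose (p + [:0, ?w:]) [:2, 1:]"
  have q: "poly q k = cost solver (k + 2) + ?w * (k + 2)" for k
    by (simp add: q_def poly_pcompose p algebra_simps)
  show ?thesis
    unfolding poly_time_solves_def
  proof (intro exI[of _ q] ballI)
    fix I assume "I \<in> {I. valid_instance I}"
    then interpret instance_input I by unfold_locales simp
    let ?xs = "encode_instance I"
    let ?L = "input_size ?xs + 2"
    let ?\<tau> = "run solver (input_memory ?xs)"
    let ?\<tau>' = "?\<tau>(1 := (?\<tau> 1)(0 := if ?\<tau> 6 0 = 0 then 1 + 4 * ?\<tau> 0 2 else 1))"
    \<comment> \<open>The encoding has \<open>2 + 2 * n + 4 * m\<close> entries of at least one bit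
      each, so both counts are bounded by the input size although they are written in
      binary.\<close>
    have "n \<le> input_size ?xs" "m \<le> input_size ?xs"
      using length_le_input_size[of ?xs] length_encode by linarith+
    then have "below ?L (input_memory ?xs)"
      by (intro input_below) (simp_all add: encode_instance_eq)
    from compile_correct[OF admissible_solver this] obtain t where
      t: "exec (compile solver) (input_memory ?xs) t ?\<tau>" "t \<le> cost solver ?L" "below ?L ?\<tau>"
      by blast
    note costs = bcost_le[OF t(3), of ?test] acost_le[OF t(3), of "Num 0"]
      acost_le[OF t(3), of "Num 1"] acost_le[OF t(3), of ?len]
    have "\<exists>t'. exec (Cond ?test (Assign 1 (Num 0) ?len) (Assign 1 (Num 0) (Num 1))) ?\<tau> t' ?\<tau>' \<and> t' \<le> ?w * ?L"
    proof (cases "bval ?test ?\<tau>")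
      case True
      have "exec (Assign 1 (Num 0) ?len) ?\<tau> (acost (Num 0) ?\<tau> + acost ?len ?\<tau>) ?\<tau>'"
        using exec.Assign[of 1 "Num 0" ?len ?\<tau>] True by simp
      from exec.CondTrue[OF True this] show ?thesis
        using costs unfolding add_mult_distrib by (intro exI conjI) (assumption, linarith)
    next
      case False
      have "exec (Assign 1 (Num 0) (Num 1)) ?\<tau> (acost (Num 0) ?\<tau> + acost (Num 1) ?\<tau>) ?\<tau>'"
        using exec.Assign[of 1 "Num 0" "Num 1" ?\<tau>] False by simp
      from exec.CondFalse[OF False this] show ?thesis
        using costs unfolding add_mult_distrib by (intro exI conjI) (assumption, linarith)
    qed
    then obtain t' where
      t': "exec (Cond ?test (Assign 1 (Num 0) ?len) (Assign 1 (Num 0) (Num 1))) ?\<tau> t' ?\<tau>'" "t' \<le> ?w * ?L"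
      by blast
    have "exec algorithm (input_memory ?xs) (t + t') ?\<tau>'"
      unfolding algorithm_def by (rule exec.Seq[OF t(1) t'(1)])
    moreover have "t + t' \<le> poly q (input_size ?xs)"
      unfolding q using t(2) t'(2) by linarith
    ultimately show "\<exists>t \<tau>. exec algorithm (input_memory ?xs) t \<tau> \<and> t \<le> poly q (input_size ?xs) \<and>
        equilibrium_answer I (output_list \<tau>)"
      using solver_answer by blast
  qed
qed

theorem theorem2p8:
  shows "(\<exists>c. poly_time_solves c encode_instance {I. valid_instance I} equilibrium_answer) \<and>
         class_price_of_anarchy (linear_games :: 'v game set) = 1 \<and>
         (\<forall>G \<in> (linear_games :: 'v game set). \<forall>s. pairwise_equilibrium G s \<longrightarrow>
            (\<exists>t. social_optimum G t) \<and>
            (\<forall>t. social_optimum G t \<longrightarrow> welfare G s = welfare G t))"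
  using algorithm_poly_time class_price_of_anarchy_linear linear_game_optimum by blast

end
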